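(* Let $\varepsilon>0$ be such that $\Lambda_\varepsilon>0$, let $P_\varepsilon\sim\varepsilon\text{-NormCRM}(\rho,\kappa P_0)$ with $P_0$ non-atomic, and let $(n_1,\dots,n_k)$ be a vector of positive integers with $\sum_{i=1}^k n_i=n$. Then the exchangeable partition probability function (eppf) associated with $P_\varepsilon$ is $$p_\varepsilon(n_1,\dots,n_k)=\int_0^{+\infty}\left[\frac{u^{n-1}}{\Gamma(n)}\,\frac{k+\Lambda_{\varepsilon,u}}{\Lambda_\varepsilon}\,e^{\Lambda_{\varepsilon,u}-\Lambda_\varepsilon}\prod_{i=1}^k\int_\varepsilon^{+\infty}\kappa\, s^{n_i}e^{-us}\rho(s)\,ds\right]du,$$ where $\Lambda_{\varepsilon,u}:=\kappa\int_\varepsilon^{+\infty}e^{-us}\rho(s)\,ds$ for $u\ge 0$.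
   Context: Setting. $\Theta\subset\mathbb{R}^m$ is a Borel set, $P_0$ is a probability measure on $\Theta$, $\kappa>0$, and $\rho:(0,+\infty)\to[0,+\infty)$ is measurable with $\int_0^{+\infty}\min\{1,s\}\rho(s)\,ds<\infty$ and $\int_0^{+\infty}\rho(s)\,ds=+\infty$. For $\varepsilon>0$ put $\Lambda_\varepsilon:=\kappa\int_\varepsilon^{+\infty}\rho(s)\,ds$ (which is finite) and, when $\Lambda_\varepsilon>0$, let $\rho_\varepsilon(s):=\frac{\kappa\rho(s)}{\Lambda_\varepsilon}\mathbb{I}_{(\varepsilon,+\infty)}(s)$, a probability density. $\varepsilon$-NormCRM$(\rho,\kappa P_0)$: let $N_\varepsilon\sim\text{Poisson}(\Lambda_\varepsilon)$; conditionally on $N_\varepsilon$, let $J_0,J_1,\dots,J_{N_\varepsilon}$ be iid with density $\rho_\varepsilon$ and, independently of these, let $\tau_0,\dots,\tau_{N_\varepsilon}$ be iid from $P_0$. With $T_\varepsilon=\sum_{j=0}^{N_\varepsilon}J_j$, the random probability measure $P_\varepsilon=\sum_{j=0}^{N_\varepsilon}\frac{J_j}{T_\varepsilon}\delta_{\tau_j}$ is called an $\varepsilon$-NormCRM$(\rho,\kappa P_0)$. Eppf: let $\theta_1,\dots,\theta_n$ be a sample from an (a.s. discrete) random probability measure $Q$, i.e. conditionally on $Q$ they are iid from $Q$. Ties among the $\theta_i$ induce a random partition of $\{1,\dots,n\}$ ($i$ and $j$ are in the same block iff $\theta_i=\theta_j$). The eppf of $Q$ evaluated at $(n_1,\dots,n_k)$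 is the probability that this random partition equals a given partition $\{C_1,\dots,C_k\}$ of $\{1,\dots,n\}$ with block sizes $\#C_i=n_i$. *)

theory Defs
  imports "HOL-Probability.Probability"
begin

definition atom_of :: "'a measure \<Rightarrow> 'a set \<Rightarrow> bool" where
  "atom_of M A \<longleftrightarrow> A \<in> sets M \<and> emeasure M A > 0 \<and>
     (\<forall>B\<in>sets M. B \<subseteq> A \<longrightarrow> emeasure M B = 0 \<or> emeasure M B = emeasure M A)"

definition non_atomic :: "'a measure \<Rightarrow> bool" where
  "non_atomic M \<longleftrightarrow> (\<nexists>A. atom_of M A)"

text \<open>
  The function \<open>\<rho>\<close> is only specified on \<open>(0, \<infinity>)\<close>; its values elsewhere are never used.
\<close>
definition jump_intensity :: "(real \<Rightarrow> real) \<Rightarrow> bool" where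
  "jump_intensity \<rho> \<longleftrightarrow>
     \<rho> \<in> borel_measurable (restrict_space borel {0<..}) \<and>
     (\<forall>s>0. \<rho> s \<ge> 0) \<and>
     (\<integral>\<^sup>+s\<in>{0<..}. ennreal (min 1 s * \<rho> s) \<partial>lborel) < \<infinity> \<and>
     (\<integral>\<^sup>+s\<in>{0<..}. ennreal (\<rho> s) \<partial>lborel) = \<infinity>"

definition Lambda_eps :: "(real \<Rightarrow> real) \<Rightarrow> real \<Rightarrow> real \<Rightarrow> real" where
  "Lambda_eps \<rho> \<kappa> \<epsilon> = \<kappa> * (LBINT s:{\<epsilon><..}. \<rho> s)"

definition Lambda_eps_u :: "(real \<Rightarrow> real) \<Rightarrow> real \<Rightarrow> real \<Rightarrow> real \<Rightarrow> real" where
  "Lambda_eps_u \<rho> \<kappa> \<epsilon> u = \<kappa> * (LBINT s:{\<epsilon><..}. exp (- u * s) * \<rho> s)"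

definition rho_eps :: "(real \<Rightarrow> real) \<Rightarrow> real \<Rightarrow> real \<Rightarrow> real \<Rightarrow> real" where
  "rho_eps \<rho> \<kappa> \<epsilon> s = \<kappa> * \<rho> s / Lambda_eps \<rho> \<kappa> \<epsilon> * indicator {\<epsilon><..} s"

text \<open>
  The law of a single jump, as a measure on the state space \<open>(0, \<infinity>)\<close>. With this state space
  the total mass \<open>T\<close> below is positive everywhere, not just almost surely.
\<close>
definition jump_law :: "(real \<Rightarrow> real) \<Rightarrow> real \<Rightarrow> real \<Rightarrow> real measure" where
  "jump_law \<rho> \<kappa> \<epsilon> =
     density (restrict_space lborel {0<..}) (\<lambda>s. ennreal (rho_eps \<rho> \<kappa> \<epsilon> s))"

definition normalized_atoms ::
    "'a measure \<Rightarrow> nat \<Rightarrow> (nat \<Rightarrow> real) \<Rightarrow> (nat \<Rightarrow> 'a) \<Rightarrow> 'a measure" where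
  "normalized_atoms S N J \<tau> =
     (let T = (\<Sum>j=0..N. J j)
      in measure_of (space S) (sets S)
           (\<lambda>B. \<Sum>j=0..N. ennreal (J j / T) * emeasure (return S (\<tau> j)) B))"

text \<open>
  The law of an \<open>\<epsilon>\<close>-NormCRM, a probability measure on the measurable space of probability
  measures: the bind over \<open>N\<close> expresses the sampling of jumps and locations conditionally on \<open>N\<close>.
\<close>
definition eps_NormCRM ::
    "(real \<Rightarrow> real) \<Rightarrow> real \<Rightarrow> 'a measure \<Rightarrow> real \<Rightarrow> 'a measure measure" where
  "eps_NormCRM \<rho> \<kappa> P\<^sub>0 \<epsilon> =
     measure_pmf (poisson_pmf (Lambda_eps \<rho> \<kappa> \<epsilon>)) \<bind> (\<lambda>N.
       distr
         ((\<Pi>\<^sub>M j\<in>{0..N}. jump_law \<rho> \<kappa> \<epsilon>) \<Otimes>\<^sub>M (\<Pi>\<^sub>M j\<in>{0..N}. P\<^sub>0))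
         (prob_algebra P\<^sub>0)
         (\<lambda>(J, \<tau>). normalized_atoms P\<^sub>0 N J \<tau>))"

definition random_prob_measure ::
    "'w measure \<Rightarrow> 'a measure \<Rightarrow> ('w \<Rightarrow> 'a measure) \<Rightarrow> bool" where
  "random_prob_measure M S Q \<longleftrightarrow> Q \<in> measurable M (prob_algebra S)"

definition sigma_gen :: "'w measure \<Rightarrow> 'b measure \<Rightarrow> ('w \<Rightarrow> 'b) \<Rightarrow> 'w measure" where
  "sigma_gen M N X = vimage_algebra (space M) X N"

text \<open>
  Conditionally on \<open>Q\<close>, the variables \<open>\<theta> 1, \<dots>, \<theta> n\<close> are iid from \<open>Q\<close>: the conditional probability
  of a product event given the sigma-algebra of \<open>Q\<close> is the product of the \<open>Q\<close>-probabilities.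
\<close>
definition sample_from ::
    "'w measure \<Rightarrow> 'a measure \<Rightarrow> ('w \<Rightarrow> 'a measure) \<Rightarrow> nat \<Rightarrow> (nat \<Rightarrow> 'w \<Rightarrow> 'a) \<Rightarrow> bool" where
  "sample_from M S Q n \<theta> \<longleftrightarrow>
     (\<forall>i\<in>{1..n}. \<theta> i \<in> measurable M S) \<and>
     (\<forall>B. (\<forall>i\<in>{1..n}. B i \<in> sets S) \<longrightarrow>
       (AE \<omega> in M.
         real_cond_exp M (sigma_gen M (prob_algebra S) Q)
           (indicator {\<omega>' \<in> space M. \<forall>i\<in>{1..n}. \<theta> i \<omega>' \<in> B i}) \<omega>
         = (\<Prod>i=1..n. measure (Q \<omega>) (B i))))"

definition tie_partition :: "nat \<Rightarrow> (nat \<Rightarrow> 'a) \<Rightarrow> nat set set" where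
  "tie_partition n x = {1..n} // {(i, j). i \<in> {1..n} \<and> j \<in> {1..n} \<and> x i = x j}"

text \<open>
  The probability that the ties in the sample produce the partition \<open>\<C>\<close>. For an exchangeable
  sample it depends on \<open>\<C>\<close> only through the block sizes.
\<close>
definition eppf :: "'w measure \<Rightarrow> nat \<Rightarrow> (nat \<Rightarrow> 'w \<Rightarrow> 'a) \<Rightarrow> nat set set \<Rightarrow> real" where
  "eppf M n \<theta> \<C> = measure M {\<omega> \<in> space M. tie_partition n (\<lambda>i. \<theta> i \<omega>) = \<C>}"

end

theory Submission
  imports Defs
begin

text \<open>
  A sample from \<open>P\<^sub>\<epsilon>\<close> can be drawn in two stages. Given the number \<open>N\<close>, the jumps \<open>J\<^sub>j\<close> with sum \<open>T\<close>
  and the sites \<open>\<tau>\<^sub>j\<close>, choose independent labels \<open>f 1, \<dots>, f n\<close> in \<open>{0..N}\<close>, the label \<open>j\<close> having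
  probability \<open>J\<^sub>j / T\<close>, and let the sampled points be \<open>\<tau>\<^bsub>f 1\<^esub>, \<dots>, \<tau>\<^bsub>f n\<^esub>\<close>. This is
  \<open>sample_law\<close>, which is proved on product events by expanding a product of sums. As \<open>P\<^sub>0\<close> has no
  atoms, the sites are almost surely distinct, so the ties among the points are the ties among
  the labels. The probability of a partition with blocks \<open>C\<^sub>1, \<dots>, C\<^sub>k\<close> is therefore the Poisson
  mixture over \<open>N\<close> of the sums of \<open>E (\<Prod>i. J\<^bsub>f i\<^esub> / T)\<close> over the labellings \<open>f\<close> whose level sets
  are these blocks.

  The jumps are independent but share the denominator \<open>T ^ n\<close>. Writing \<open>1 / T ^ n\<close> as
  \<open>1 / \<Gamma>(n)\<close> times the integral of \<open>u ^ (n - 1) * exp (- u * T)\<close> over \<open>u\<close>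
  (\<open>inverse_power_eq_gamma_integral\<close>) lets the expectation factor over the atoms
  (\<open>expectation_normalized_jumps\<close>). An atom chosen by the block \<open>C\<^sub>i\<close> contributes the tilted moment
  of order \<open>n\<^sub>i\<close> divided by \<open>\<Lambda>\<^sub>\<epsilon>\<close>, and each of the \<open>N + 1 - k\<close> other atoms contributes
  \<open>\<Lambda>\<^sub>\<epsilon>\<^sub>,\<^sub>u / \<Lambda>\<^sub>\<epsilon>\<close>. There are \<open>(N + 1) * N * \<dots> * (N + 2 - k)\<close> labellings (\<open>card_labellings\<close>), all with
  the same weight, and the sum over \<open>N\<close> is an exponential series
  (\<open>poisson_factorial_moment_series\<close>). The factor \<open>k + \<Lambda>\<^sub>\<epsilon>\<^sub>,\<^sub>u\<close> of the formula comes from there: it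
  reflects that the number of atoms is one more than a Poisson variable.
\<close>

section \<open>Exponentially tilted moments of the jumps\<close>

text \<open>
  A single term of the exponential series of \<open>u * s\<close> is at most \<open>exp (u * s)\<close>. The bound is
  uniform in \<open>s\<close>, which makes every exponentially tilted moment of the jump intensity finite.
\<close>

lemma power_times_exp_minus_le:
  fixes u s :: real
  assumes "u > 0" "s \<ge> 0"
  shows "s ^ m * exp (- u * s) \<le> fact m / u ^ m"
proof -
  have "summable (\<lambda>i. (u * s) ^ i /\<^sub>R fact i)"
    by (rule summable_exp_generic)
  then have "(\<Sum>i\<in>{m}. (u * s) ^ i /\<^sub>R fact i) \<le> exp (u * s)"
    unfolding exp_def using assms by (intro sum_le_suminf) auto
  then have "(u * s) ^ m / fact m \<le> exp (u * s)"
    by (simp add: divide_inverse mult.commute)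
  then show ?thesis
    using assms by (simp add: exp_minus field_simps power_mult_distrib)
qed

locale truncated_jumps =
  fixes \<rho> :: "real \<Rightarrow> real" and \<kappa> \<epsilon> :: real
  assumes kappa_pos: "\<kappa> > 0" and eps_pos: "\<epsilon> > 0"
    and intensity: "jump_intensity \<rho>"
    and Lambda_pos: "Lambda_eps \<rho> \<kappa> \<epsilon> > 0"
begin

abbreviation "\<Lambda> \<equiv> Lambda_eps \<rho> \<kappa> \<epsilon>"

abbreviation "J_law \<equiv> jump_law \<rho> \<kappa> \<epsilon>"

text \<open>
  For \<open>m = n\<^sub>i\<close> this is the inner integral of the eppf formula, and for \<open>m = 0\<close> it is
  \<open>\<Lambda>\<^sub>\<epsilon>\<^sub>,\<^sub>u\<close>: an occupied atom and an empty atom are treated alike.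
\<close>

definition tilted_moment :: "nat \<Rightarrow> real \<Rightarrow> real" where
  "tilted_moment m u = (LBINT s:{\<epsilon><..}. \<kappa> * s ^ m * exp (- u * s) * \<rho> s)"

lemma truncated_intensity_measurable [measurable]:
  "(\<lambda>s. indicator {\<epsilon><..} s * \<rho> s) \<in> borel_measurable borel"
proof -
  have "(\<lambda>s. indicator {0<..} s *\<^sub>R \<rho> s) \<in> borel_measurable borel"
    using intensity unfolding jump_intensity_def
    by (subst (asm) borel_measurable_restrict_space_iff) auto
  then have "(\<lambda>s. indicator {\<epsilon><..} s * (indicator {0<..} s *\<^sub>R \<rho> s)) \<in> borel_measurable borel"
    by measurable
  also have "(\<lambda>s. indicator {\<epsilon><..} s * (indicator {0<..} s *\<^sub>R \<rho> s)) =
      (\<lambda>s. indicator {\<epsilon><..} s * \<rho> s)"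
    using eps_pos by (auto simp: fun_eq_iff indicator_def)
  finally show ?thesis .
qed

lemma truncated_intensity_nonneg: "0 \<le> indicator {\<epsilon><..} s * \<rho> s"
  using intensity eps_pos by (auto simp: jump_intensity_def indicator_def)

text \<open>
  Beyond \<open>\<epsilon>\<close> the weight \<open>min 1 s\<close> is bounded below by \<open>min 1 \<epsilon>\<close>, so integrability of
  \<open>min 1 s * \<rho> s\<close> gives integrability of \<open>\<rho>\<close> there.
\<close>

lemma integrable_truncated_intensity:
  "integrable lborel (\<lambda>s. indicator {\<epsilon><..} s * \<rho> s)"
proof (rule integrableI_nonneg)
  have "(\<integral>\<^sup>+s. ennreal (indicator {\<epsilon><..} s * \<rho> s) \<partial>lborel) \<le>
      (\<integral>\<^sup>+s. ennreal (1 / min 1 \<epsilon>) * (ennreal (min 1 s * \<rho> s) * indicator {0<..} s) \<partial>lborel)"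
  proof (rule nn_integral_mono)
    fix s :: real
    show "ennreal (indicator {\<epsilon><..} s * \<rho> s) \<le>
        ennreal (1 / min 1 \<epsilon>) * (ennreal (min 1 s * \<rho> s) * indicator {0<..} s)"
    proof (cases "s > \<epsilon>")
      case True
      then have "0 \<le> \<rho> s"
        using intensity eps_pos by (auto simp: jump_intensity_def)
      moreover have "1 \<le> 1 / min 1 \<epsilon> * min 1 s"
        using True eps_pos by (auto simp: min_def field_simps)
      ultimately have "\<rho> s \<le> 1 / min 1 \<epsilon> * min 1 s * \<rho> s"
        using mult_right_mono[of 1 "1 / min 1 \<epsilon> * min 1 s" "\<rho> s"] by simp
      then show ?thesis
        using True eps_pos by (simp add: ennreal_mult'[symmetric] ennreal_leI mult.assoc)
    qed simp
  qed
  also have "\<dots> = ennreal (1 / min 1 \<epsilon>) * (\<integral>\<^sup>+s\<in>{0<..}. ennreal (min 1 s * \<rho> s) \<partial>lborel)"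
  proof (rule nn_integral_cmult)
    have "(\<lambda>s. indicator {0<..} s *\<^sub>R \<rho> s) \<in> borel_measurable borel"
      using intensity unfolding jump_intensity_def
      by (subst (asm) borel_measurable_restrict_space_iff) auto
    then have "(\<lambda>s. ennreal (min 1 s * (indicator {0<..} s *\<^sub>R \<rho> s))) \<in> borel_measurable lborel"
      by measurable
    also have "(\<lambda>s. ennreal (min 1 s * (indicator {0<..} s *\<^sub>R \<rho> s))) =
        (\<lambda>s. ennreal (min 1 s * \<rho> s) * indicator {0<..} s)"
      by (auto simp: indicator_def)
    finally show "(\<lambda>s. ennreal (min 1 s * \<rho> s) * indicator {0<..} s) \<in> borel_measurable lborel" .
  qed
  also have "\<dots> < \<infinity>"
    using intensity by (auto simp: jump_intensity_def ennreal_mult_less_top)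
  finally show "(\<integral>\<^sup>+s. ennreal (indicator {\<epsilon><..} s * \<rho> s) \<partial>lborel) < \<infinity>" .
qed (auto simp: truncated_intensity_nonneg)

lemma integrable_tilted:
  assumes "u > 0"
  shows "integrable lborel (\<lambda>s. \<kappa> * s ^ m * exp (- u * s) * (indicator {\<epsilon><..} s * \<rho> s))"
proof (rule Bochner_Integration.integrable_bound)
  show "integrable lborel (\<lambda>s. \<kappa> * (fact m / u ^ m) * (indicator {\<epsilon><..} s * \<rho> s))"
    by (intro integrable_mult_right integrable_truncated_intensity)
  show "AE s in lborel. norm (\<kappa> * s ^ m * exp (- u * s) * (indicator {\<epsilon><..} s * \<rho> s))
      \<le> norm (\<kappa> * (fact m / u ^ m) * (indicator {\<epsilon><..} s * \<rho> s))"
  proof (rule AE_I2)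
    fix s :: real
    have *: "0 \<le> indicator {\<epsilon><..} s * \<rho> s"
      by (rule truncated_intensity_nonneg)
    show "norm (\<kappa> * s ^ m * exp (- u * s) * (indicator {\<epsilon><..} s * \<rho> s))
      \<le> norm (\<kappa> * (fact m / u ^ m) * (indicator {\<epsilon><..} s * \<rho> s))"
    proof (cases "s > \<epsilon>")
      case True
      have "(\<kappa> * (s ^ m * exp (- u * s))) * (indicator {\<epsilon><..} s * \<rho> s)
          \<le> (\<kappa> * (fact m / u ^ m)) * (indicator {\<epsilon><..} s * \<rho> s)"
        using True eps_pos kappa_pos assms
        by (intro mult_right_mono mult_left_mono power_times_exp_minus_le *) auto
      moreover have "0 \<le> (\<kappa> * (s ^ m * exp (- u * s))) * (indicator {\<epsilon><..} s * \<rho> s)"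
        using True eps_pos kappa_pos * by (intro mult_nonneg_nonneg) auto
      ultimately show ?thesis
        unfolding real_norm_def mult.assoc[symmetric] by linarith
    qed simp
  qed
qed measurable

lemma tilted_moment_eq:
  "tilted_moment m u = (\<integral>s. \<kappa> * s ^ m * exp (- u * s) * (indicator {\<epsilon><..} s * \<rho> s) \<partial>lborel)"
  unfolding tilted_moment_def set_lebesgue_integral_def
  by (intro Bochner_Integration.integral_cong) (auto simp: indicator_def)

lemma tilted_moment_nonneg: "0 \<le> tilted_moment m u"
  unfolding tilted_moment_eq
proof (rule Bochner_Integration.integral_nonneg)
  fix s :: real
  show "0 \<le> \<kappa> * s ^ m * exp (- u * s) * (indicator {\<epsilon><..} s * \<rho> s)"
    using kappa_pos eps_pos truncated_intensity_nonneg[of s]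
    by (cases "s > \<epsilon>") auto
qed

lemma tilted_moment_measurable [measurable]: "tilted_moment m \<in> borel_measurable borel"
proof -
  have "(\<lambda>u. \<integral>s. \<kappa> * s ^ m * exp (- u * s) * (indicator {\<epsilon><..} s * \<rho> s) \<partial>lborel)
      \<in> borel_measurable borel"
    by measurable
  then show ?thesis unfolding tilted_moment_eq[abs_def] .
qed

lemma Lambda_eps_u_eq_tilted_moment: "Lambda_eps_u \<rho> \<kappa> \<epsilon> u = tilted_moment 0 u"
  unfolding Lambda_eps_u_def tilted_moment_def
  by (simp add: mult.assoc)

lemma rho_eps_eq: "rho_eps \<rho> \<kappa> \<epsilon> s = \<kappa> / \<Lambda> * (indicator {\<epsilon><..} s * \<rho> s)"
  unfolding rho_eps_def by simp

lemma nn_integral_jump_law: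
  assumes [measurable]: "g \<in> borel_measurable borel"
  shows "(\<integral>\<^sup>+s. g s \<partial>J_law) = (\<integral>\<^sup>+s. ennreal (rho_eps \<rho> \<kappa> \<epsilon> s) * g s \<partial>lborel)"
proof -
  have [measurable]: "(\<lambda>s. rho_eps \<rho> \<kappa> \<epsilon> s) \<in> borel_measurable borel"
    unfolding rho_eps_eq by measurable
  have "(\<integral>\<^sup>+s. g s \<partial>J_law) =
      (\<integral>\<^sup>+s. ennreal (rho_eps \<rho> \<kappa> \<epsilon> s) * g s \<partial>restrict_space lborel {0<..})"
    unfolding jump_law_def
    by (intro nn_integral_density measurable_restrict_space1) measurable
  also have "\<dots> = (\<integral>\<^sup>+s. ennreal (rho_eps \<rho> \<kappa> \<epsilon> s) * g s * indicator {0<..} s \<partial>lborel)"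
    by (subst nn_integral_restrict_space) auto
  also have "\<dots> = (\<integral>\<^sup>+s. ennreal (rho_eps \<rho> \<kappa> \<epsilon> s) * g s \<partial>lborel)"
    using eps_pos by (intro nn_integral_cong) (auto simp: rho_eps_def indicator_def)
  finally show ?thesis .
qed

lemma space_jump_law: "space J_law = {0<..}"
  by (simp add: jump_law_def space_restrict_space)

lemma sets_jump_law: "sets J_law = sets (restrict_space borel {0<..})"
  by (simp add: jump_law_def sets_restrict_space)

lemma borel_measurable_jump_law: "f \<in> borel_measurable borel \<Longrightarrow> f \<in> borel_measurable J_law"
  by (subst measurable_cong_sets[OF sets_jump_law refl]) (rule measurable_restrict_space1)

lemma jump_law_tilted_moment:
  assumes "u > 0"
  shows "(\<integral>\<^sup>+s. ennreal (s ^ m * exp (- u * s)) \<partial>J_law) = ennreal (tilted_moment m u / \<Lambda>)"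
proof -
  have "(\<integral>\<^sup>+s. ennreal (s ^ m * exp (- u * s)) \<partial>J_law) =
      (\<integral>\<^sup>+s. ennreal (rho_eps \<rho> \<kappa> \<epsilon> s) * ennreal (s ^ m * exp (- u * s)) \<partial>lborel)"
    by (rule nn_integral_jump_law) measurable
  also have "\<dots> =
      (\<integral>\<^sup>+s. ennreal (\<kappa> * s ^ m * exp (- u * s) * (indicator {\<epsilon><..} s * \<rho> s) / \<Lambda>) \<partial>lborel)"
  proof (intro nn_integral_cong)
    fix s :: real
    show "ennreal (rho_eps \<rho> \<kappa> \<epsilon> s) * ennreal (s ^ m * exp (- u * s)) =
      ennreal (\<kappa> * s ^ m * exp (- u * s) * (indicator {\<epsilon><..} s * \<rho> s) / \<Lambda>)"
      using truncated_intensity_nonneg[of s] kappa_pos Lambda_pos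
      unfolding rho_eps_eq
      by (subst ennreal_mult'[symmetric]) (auto simp: field_simps)
  qed
  also have "\<dots> =
      ennreal (\<integral>s. \<kappa> * s ^ m * exp (- u * s) * (indicator {\<epsilon><..} s * \<rho> s) / \<Lambda> \<partial>lborel)"
  proof (rule nn_integral_eq_integral)
    show "integrable lborel
        (\<lambda>s. \<kappa> * s ^ m * exp (- u * s) * (indicator {\<epsilon><..} s * \<rho> s) / \<Lambda>)"
      by (intro integrable_divide integrable_tilted assms)
    show "AE s in lborel. 0 \<le> \<kappa> * s ^ m * exp (- u * s) * (indicator {\<epsilon><..} s * \<rho> s) / \<Lambda>"
    proof (rule AE_I2)
      fix s :: real
      show "0 \<le> \<kappa> * s ^ m * exp (- u * s) * (indicator {\<epsilon><..} s * \<rho> s) / \<Lambda>"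
        using kappa_pos eps_pos Lambda_pos truncated_intensity_nonneg[of s]
        by (cases "s > \<epsilon>") auto
    qed
  qed
  also have "\<dots> = ennreal (tilted_moment m u / \<Lambda>)"
    unfolding tilted_moment_eq by simp
  finally show ?thesis .
qed

sublocale J: prob_space J_law
proof
  have "emeasure J_law (space J_law) = (\<integral>\<^sup>+s. 1 \<partial>J_law)"
    by simp
  also have "\<dots> = (\<integral>\<^sup>+s. ennreal (rho_eps \<rho> \<kappa> \<epsilon> s) * 1 \<partial>lborel)"
    by (rule nn_integral_jump_law) simp
  also have "\<dots> = ennreal (\<integral>s. \<kappa> / \<Lambda> * (indicator {\<epsilon><..} s * \<rho> s) \<partial>lborel)"
    unfolding rho_eps_eq mult_1_right
    using kappa_pos Lambda_pos
    by (intro nn_integral_eq_integral integrable_mult_right integrable_truncated_intensity AE_I2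
        mult_nonneg_nonneg truncated_intensity_nonneg) auto
  also have "(\<integral>s. \<kappa> / \<Lambda> * (indicator {\<epsilon><..} s * \<rho> s) \<partial>lborel) = \<Lambda> / \<Lambda>"
    by (simp add: Lambda_eps_def set_lebesgue_integral_def)
  finally show "emeasure J_law (space J_law) = 1"
    using Lambda_pos by simp
qed

end

section \<open>Expected products of normalized jumps\<close>

text \<open>
  This identity is what decouples the jumps: the power of the total mass \<open>T\<close> in the
  denominator becomes an exponential of a sum. It is the normalisation of the Erlang density
  of shape \<open>n\<close> and rate \<open>T\<close>.
\<close>

lemma inverse_power_eq_gamma_integral:
  assumes "T > 0" "n \<ge> 1"
  shows "ennreal (1 / T ^ n) =
    (\<integral>\<^sup>+u\<in>{0<..}. ennreal (u ^ (n - 1) / Gamma (real n) * exp (- u * T)) \<partial>lborel)"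
proof -
  interpret E: prob_space "density lborel (erlang_density (n - 1) T)"
    by (rule prob_space_erlang_density) fact
  have "1 = (\<integral>\<^sup>+u. ennreal (erlang_density (n - 1) T u) \<partial>lborel)"
    using E.emeasure_space_1 by (simp add: emeasure_density)
  also have "\<dots> = (\<integral>\<^sup>+u. ennreal (T ^ n) *
      (ennreal (u ^ (n - 1) / Gamma (real n) * exp (- u * T)) * indicator {0<..} u) \<partial>lborel)"
  proof (rule nn_integral_cong_AE)
    \<comment> \<open>At \<open>u = 0\<close> the Erlang density of shape \<open>n = 1\<close> is positive, but the right-hand side is zero.\<close>
    have "AE u in lborel. u \<noteq> (0::real)"
      by (rule AE_lborel_singleton)
    then show "AE u in lborel. ennreal (erlang_density (n - 1) T u) = ennreal (T ^ n) *
      (ennreal (u ^ (n - 1) / Gamma (real n) * exp (- u * T)) * indicator {0<..} u)"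
    proof eventually_elim
      case (elim u)
      have "Gamma (real n) = fact (n - 1)"
        using Gamma_fact[of "n - 1", where ?'a = real] assms by (simp add: of_nat_diff)
      then show ?case
        using elim assms
        by (auto simp: erlang_density_def indicator_def mult_ac simp flip: ennreal_mult')
    qed
  qed
  also have "\<dots> = ennreal (T ^ n) *
      (\<integral>\<^sup>+u\<in>{0<..}. ennreal (u ^ (n - 1) / Gamma (real n) * exp (- u * T)) \<partial>lborel)"
    by (rule nn_integral_cmult) measurable
  finally have "ennreal (1 / T ^ n) * 1 = ennreal (1 / T ^ n) * (ennreal (T ^ n) *
      (\<integral>\<^sup>+u\<in>{0<..}. ennreal (u ^ (n - 1) / Gamma (real n) * exp (- u * T)) \<partial>lborel))"
    by simp
  also have "\<dots> = (\<integral>\<^sup>+u\<in>{0<..}. ennreal (u ^ (n - 1) / Gamma (real n) * exp (- u * T)) \<partial>lborel)"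
    using assms by (simp add: mult.assoc[symmetric] flip: ennreal_mult')
  finally show ?thesis by simp
qed

context truncated_jumps begin

lemma jump_component_measurable:
  assumes "j \<in> I"
  shows "(\<lambda>x. x j) \<in> borel_measurable (\<Pi>\<^sub>M j\<in>I. J_law)"
  by (rule measurable_compose[OF measurable_component_singleton[OF assms] borel_measurable_jump_law])
    simp

text \<open>
  Grouping the sampled indices \<open>i\<close> by their label \<open>f i\<close> turns the numerator into powers
  \<open>x j ^ m j\<close>, where \<open>m j\<close> counts the occurrences of the label \<open>j\<close>; the Gamma integral then
  distributes \<open>1 / T ^ n\<close> over the factors.
\<close>

lemma product_normalized_jumps:
  fixes f :: "nat \<Rightarrow> 'i" and x :: "'i \<Rightarrow> real"
  assumes I: "finite I" and f: "f ` {1..n} \<subseteq> I" and n: "n \<ge> 1"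
    and pos: "\<And>j. j \<in> I \<Longrightarrow> x j > 0"
  defines "m \<equiv> \<lambda>j. card {i \<in> {1..n}. f i = j}"
  shows "(\<Prod>i=1..n. ennreal (x (f i) / (\<Sum>j\<in>I. x j))) =
    (\<integral>\<^sup>+u\<in>{0<..}. ennreal (u ^ (n - 1) / Gamma (real n)) *
       (\<Prod>j\<in>I. ennreal (x j ^ m j * exp (- u * x j))) \<partial>lborel)"
proof -
  define T where "T = (\<Sum>j\<in>I. x j)"
  have "f 1 \<in> I" using f n by auto
  then have T: "T > 0"
    unfolding T_def using I pos by (intro sum_pos) auto
  have pow: "(\<Prod>i=1..n. x (f i)) = (\<Prod>j\<in>I. x j ^ m j)"
  proof -
    have "(\<Prod>i=1..n. x (f i)) = (\<Prod>j\<in>I. \<Prod>i\<in>{i \<in> {1..n}. f i = j}. x (f i))"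
      using I f by (intro prod.group[symmetric]) auto
    then show ?thesis by (simp add: m_def)
  qed
  have pow_nonneg: "0 \<le> (\<Prod>j\<in>I. x j ^ m j)"
    using pos by (intro prod_nonneg zero_le_power) (simp add: less_imp_le)
  have "(\<Prod>i=1..n. ennreal (x (f i) / T)) = ennreal (\<Prod>i=1..n. x (f i) / T)"
    using T pos f
    by (intro prod_ennreal divide_nonneg_pos less_imp_le[OF pos]) auto
  also have "(\<Prod>i=1..n. x (f i) / T) = (\<Prod>j\<in>I. x j ^ m j) * (1 / T ^ n)"
    unfolding pow[symmetric] by (simp add: prod_dividef)
  also have "ennreal \<dots> = ennreal (\<Prod>j\<in>I. x j ^ m j) * ennreal (1 / T ^ n)"
    using pow_nonneg by (rule ennreal_mult')
  also have "\<dots> = (\<integral>\<^sup>+u. ennreal (\<Prod>j\<in>I. x j ^ m j) *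
      (ennreal (u ^ (n - 1) / Gamma (real n) * exp (- u * T)) * indicator {0<..} u) \<partial>lborel)"
    unfolding inverse_power_eq_gamma_integral[OF T n]
    by (rule nn_integral_cmult[symmetric]) measurable
  also have "\<dots> = (\<integral>\<^sup>+u\<in>{0<..}. ennreal (u ^ (n - 1) / Gamma (real n)) *
       (\<Prod>j\<in>I. ennreal (x j ^ m j * exp (- u * x j))) \<partial>lborel)"
  proof (intro nn_integral_cong)
    fix u :: real
    show "ennreal (\<Prod>j\<in>I. x j ^ m j) *
        (ennreal (u ^ (n - 1) / Gamma (real n) * exp (- u * T)) * indicator {0<..} u) =
      ennreal (u ^ (n - 1) / Gamma (real n)) *
       (\<Prod>j\<in>I. ennreal (x j ^ m j * exp (- u * x j))) * indicator {0<..} u"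
    proof (cases "u > 0")
      case True
      have "(\<Prod>j\<in>I. ennreal (x j ^ m j * exp (- u * x j))) =
          ennreal (\<Prod>j\<in>I. x j ^ m j * exp (- u * x j))"
        using pos by (intro prod_ennreal) (auto intro!: mult_nonneg_nonneg zero_le_power less_imp_le)
      also have "(\<Prod>j\<in>I. x j ^ m j * exp (- u * x j)) = (\<Prod>j\<in>I. x j ^ m j) * exp (- u * T)"
        using I by (simp add: prod.distrib T_def sum_distrib_left exp_sum sum_negf flip: exp_sum)
      finally show ?thesis
        using True pow_nonneg n Gamma_real_pos[of "real n"]
        by (simp add: mult_ac less_imp_le flip: ennreal_mult')
    qed simp
  qed
  finally show ?thesis unfolding T_def .
qed

text \<open>
  For fixed \<open>u\<close> the integrand of the previous lemma is a product of functions of the single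
  jumps, so by Tonelli and independence its expectation is the product of the expectations.
\<close>

lemma expectation_normalized_jumps:
  fixes f :: "nat \<Rightarrow> 'i"
  assumes I: "finite I" and f: "f ` {1..n} \<subseteq> I" and n: "n \<ge> 1"
  shows "(\<integral>\<^sup>+x. (\<Prod>i=1..n. ennreal (x (f i) / (\<Sum>j\<in>I. x j))) \<partial>(\<Pi>\<^sub>M j\<in>I. J_law)) =
    (\<integral>\<^sup>+u\<in>{0<..}. ennreal (u ^ (n - 1) / Gamma (real n)) *
       (\<Prod>j\<in>I. ennreal (tilted_moment (card {i \<in> {1..n}. f i = j}) u / \<Lambda>)) \<partial>lborel)"
proof -
  define m where "m j = card {i \<in> {1..n}. f i = j}" for j
  interpret P: product_prob_space "\<lambda>_::'i. J_law" I
    by unfold_locales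
  interpret PI: prob_space "\<Pi>\<^sub>M j\<in>I. J_law"
    by (rule P.prob_space_axioms)
  interpret pair_sigma_finite "\<Pi>\<^sub>M j\<in>I. J_law" "lborel :: real measure"
    by unfold_locales
  have comp [measurable]: "(\<lambda>x. x j) \<in> borel_measurable (\<Pi>\<^sub>M j\<in>I. J_law)" if "j \<in> I" for j
    using that by (rule jump_component_measurable)
  have factor [measurable]:
    "(\<lambda>(x, u). ennreal (x j ^ m j * exp (- u * x j)))
      \<in> borel_measurable ((\<Pi>\<^sub>M j\<in>I. J_law) \<Otimes>\<^sub>M lborel)" if "j \<in> I" for j
  proof -
    have [measurable]: "(\<lambda>p. fst p j) \<in> borel_measurable ((\<Pi>\<^sub>M j\<in>I. J_law) \<Otimes>\<^sub>M (lborel::real measure))"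
      by (rule measurable_compose[OF measurable_fst comp[OF that]])
    show ?thesis unfolding split_beta by measurable
  qed
  have "(\<integral>\<^sup>+x. (\<Prod>i=1..n. ennreal (x (f i) / (\<Sum>j\<in>I. x j))) \<partial>(\<Pi>\<^sub>M j\<in>I. J_law)) =
    (\<integral>\<^sup>+x. (\<integral>\<^sup>+u. ennreal (u ^ (n - 1) / Gamma (real n)) *
       (\<Prod>j\<in>I. ennreal (x j ^ m j * exp (- u * x j))) * indicator {0<..} u \<partial>lborel)
      \<partial>(\<Pi>\<^sub>M j\<in>I. J_law))"
    unfolding m_def
    by (intro nn_integral_cong product_normalized_jumps assms)
      (auto simp: space_PiM space_jump_law dest: PiE_mem)
  also have "\<dots> = (\<integral>\<^sup>+u. (\<integral>\<^sup>+x. ennreal (u ^ (n - 1) / Gamma (real n)) *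
       (\<Prod>j\<in>I. ennreal (x j ^ m j * exp (- u * x j))) * indicator {0<..} u
      \<partial>(\<Pi>\<^sub>M j\<in>I. J_law)) \<partial>lborel)"
  proof (rule Fubini'[symmetric])
    have "(\<lambda>p. \<Prod>j\<in>I. ennreal (fst p j ^ m j * exp (- snd p * fst p j)))
        \<in> borel_measurable ((\<Pi>\<^sub>M j\<in>I. J_law) \<Otimes>\<^sub>M lborel)"
      using factor by (intro borel_measurable_prod_ennreal) (auto simp: split_beta)
    then show "(\<lambda>(x, u). ennreal (u ^ (n - 1) / Gamma (real n)) *
       (\<Prod>j\<in>I. ennreal (x j ^ m j * exp (- u * x j))) * indicator {0<..} u)
      \<in> borel_measurable ((\<Pi>\<^sub>M j\<in>I. J_law) \<Otimes>\<^sub>M lborel)"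
      unfolding split_beta by measurable
  qed
  also have "\<dots> = (\<integral>\<^sup>+u\<in>{0<..}. ennreal (u ^ (n - 1) / Gamma (real n)) *
       (\<Prod>j\<in>I. ennreal (tilted_moment (m j) u / \<Lambda>)) \<partial>lborel)"
  proof (intro nn_integral_cong)
    fix u :: real
    show "(\<integral>\<^sup>+x. ennreal (u ^ (n - 1) / Gamma (real n)) *
       (\<Prod>j\<in>I. ennreal (x j ^ m j * exp (- u * x j))) * indicator {0<..} u
      \<partial>(\<Pi>\<^sub>M j\<in>I. J_law)) = ennreal (u ^ (n - 1) / Gamma (real n)) *
       (\<Prod>j\<in>I. ennreal (tilted_moment (m j) u / \<Lambda>)) * indicator {0<..} u"
    proof (cases "u > 0")
      case True
      have meas: "(\<lambda>s. ennreal (s ^ m j * exp (- u * s))) \<in> borel_measurable J_law" for j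
        by (rule borel_measurable_jump_law) measurable
      have [measurable]: "(\<lambda>x. \<Prod>j\<in>I. ennreal (x j ^ m j * exp (- u * x j)))
          \<in> borel_measurable (\<Pi>\<^sub>M j\<in>I. J_law)"
        by measurable
      have "(\<integral>\<^sup>+x. (\<Prod>j\<in>I. ennreal (x j ^ m j * exp (- u * x j))) \<partial>(\<Pi>\<^sub>M j\<in>I. J_law)) =
          (\<Prod>j\<in>I. ennreal (tilted_moment (m j) u / \<Lambda>))"
        using P.product_nn_integral_prod[OF I, of "\<lambda>j s. ennreal (s ^ m j * exp (- u * s))"] meas
        by (simp add: jump_law_tilted_moment[OF True, simplified])
      then show ?thesis using True
        by (simp add: nn_integral_cmult)
    qed simp
  qed
  finally show ?thesis unfolding m_def .
qed

end

section \<open>The normalized random measure\<close>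

text \<open>
  Since the measure is given by its values on measurable sets, these values must first be
  shown to be countably additive; this is inherited from the Dirac measures. All jumps being
  positive, the total mass is positive and the weights add up to one.
\<close>

lemma normalized_atoms:
  assumes J: "\<And>j. j \<le> N \<Longrightarrow> J j > 0" and \<tau>: "\<And>j. j \<le> N \<Longrightarrow> \<tau> j \<in> space S"
  shows sets_normalized_atoms: "sets (normalized_atoms S N J \<tau>) = sets S"
    and emeasure_normalized_atoms: "B \<in> sets S \<Longrightarrow> emeasure (normalized_atoms S N J \<tau>) B =
      (\<Sum>j=0..N. ennreal (J j / (\<Sum>j=0..N. J j)) * indicator B (\<tau> j))"
    and prob_space_normalized_atoms: "prob_space (normalized_atoms S N J \<tau>)"
proof -
  define T where "T = (\<Sum>j=0..N. J j)"
  have T: "T > 0"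
    unfolding T_def using J by (intro sum_pos) auto
  let ?\<mu> = "\<lambda>B. \<Sum>j=0..N. ennreal (J j / T) * emeasure (return S (\<tau> j)) B"
  have eq: "normalized_atoms S N J \<tau> = measure_of (space S) (sets S) ?\<mu>"
    unfolding normalized_atoms_def T_def Let_def ..
  show s: "sets (normalized_atoms S N J \<tau>) = sets S"
    unfolding eq by (simp add: sets.space_closed sets.sigma_sets_eq)
  show em: "emeasure (normalized_atoms S N J \<tau>) B =
      (\<Sum>j=0..N. ennreal (J j / (\<Sum>j=0..N. J j)) * indicator B (\<tau> j))" if "B \<in> sets S" for B
  proof -
    have "emeasure (normalized_atoms S N J \<tau>) B = ?\<mu> B"
    proof (rule emeasure_measure_of[OF eq])
      show "sets S \<subseteq> Pow (space S)" by (rule sets.space_closed)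
      show "B \<in> sets (normalized_atoms S N J \<tau>)" using s that by simp
      show "positive (sets (normalized_atoms S N J \<tau>)) ?\<mu>"
        by (simp add: positive_def)
      show "countably_additive (sets (normalized_atoms S N J \<tau>)) ?\<mu>"
      proof (rule countably_additiveI)
        fix A :: "nat \<Rightarrow> 'a set"
        assume A: "range A \<subseteq> sets (normalized_atoms S N J \<tau>)" "disjoint_family A"
        have *: "(\<Sum>i. ennreal (J j / T) * emeasure (return S (\<tau> j)) (A i)) =
            ennreal (J j / T) * emeasure (return S (\<tau> j)) (\<Union>i. A i)" for j
          using A by (simp add: suminf_emeasure s del: emeasure_return)
        have "(\<Sum>i. ?\<mu> (A i)) =
            (\<Sum>j=0..N. \<Sum>i. ennreal (J j / T) * emeasure (return S (\<tau> j)) (A i))"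
          by (intro suminf_sum) auto
        then show "(\<Sum>i. ?\<mu> (A i)) = ?\<mu> (\<Union>i. A i)"
          by (simp only: *)
      qed
    qed
    then show ?thesis using that by (simp add: T_def)
  qed
  show "prob_space (normalized_atoms S N J \<tau>)"
  proof
    have "emeasure (normalized_atoms S N J \<tau>) (space (normalized_atoms S N J \<tau>)) =
        (\<Sum>j=0..N. ennreal (J j / T))"
      using \<tau> by (simp add: sets_eq_imp_space_eq[OF s] em flip: T_def)
    also have "\<dots> = ennreal (\<Sum>j=0..N. J j / T)"
      using J T by (intro sum_ennreal) (auto intro!: divide_nonneg_nonneg less_imp_le)
    also have "(\<Sum>j=0..N. J j / T) = 1"
      using T by (simp add: T_def flip: sum_divide_distrib)
    finally show "emeasure (normalized_atoms S N J \<tau>) (space (normalized_atoms S N J \<tau>)) = 1"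
      by simp
  qed
qed

locale normalized_crm = truncated_jumps \<rho> \<kappa> \<epsilon> + P0: prob_space P\<^sub>0
  for \<rho> \<kappa> \<epsilon> and P\<^sub>0 :: "'a measure"
begin

abbreviation "jumps N \<equiv> (\<Pi>\<^sub>M j\<in>{0..N::nat}. J_law)"
abbreviation "sites N \<equiv> (\<Pi>\<^sub>M j\<in>{0..N::nat}. P\<^sub>0)"

lemma prob_space_jumps: "prob_space (jumps N)"
  by (intro prob_space_PiM J.prob_space_axioms)

lemma prob_space_sites: "prob_space (sites N)"
  by (intro prob_space_PiM P0.prob_space_axioms)

lemma jumps_sites_space:
  assumes "p \<in> space (jumps N \<Otimes>\<^sub>M sites N)" "j \<le> N"
  shows "fst p j > 0" "snd p j \<in> space P\<^sub>0"
  using assms by (auto simp: space_pair_measure space_PiM space_jump_law PiE_iff)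

lemma normalized_atoms_measurable:
  "(\<lambda>(J, \<tau>). normalized_atoms P\<^sub>0 N J \<tau>) \<in> (jumps N \<Otimes>\<^sub>M sites N) \<rightarrow>\<^sub>M prob_algebra P\<^sub>0"
proof (intro measurable_prob_algebraI measurable_subprob_algebra)
  fix p assume p: "p \<in> space (jumps N \<Otimes>\<^sub>M sites N)"
  show pr: "prob_space (case p of (J, \<tau>) \<Rightarrow> normalized_atoms P\<^sub>0 N J \<tau>)"
    unfolding split_beta
    by (rule prob_space_normalized_atoms) (use p jumps_sites_space in blast)+
  then show "subprob_space (case p of (J, \<tau>) \<Rightarrow> normalized_atoms P\<^sub>0 N J \<tau>)"
    by (rule prob_space_imp_subprob_space)
  show "sets (case p of (J, \<tau>) \<Rightarrow> normalized_atoms P\<^sub>0 N J \<tau>) = sets P\<^sub>0"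
    unfolding split_beta
    by (rule sets_normalized_atoms) (use p jumps_sites_space in blast)+
next
  fix B assume B [measurable]: "B \<in> sets P\<^sub>0"
  have "(\<lambda>p. \<Sum>j=0..N. ennreal (fst p j / (\<Sum>j=0..N. fst p j)) * indicator B (snd p j))
      \<in> borel_measurable (jumps N \<Otimes>\<^sub>M sites N)"
  proof -
    have [measurable]: "(\<lambda>p. fst p j) \<in> borel_measurable (jumps N \<Otimes>\<^sub>M sites N)"
      if "j \<in> {0..N}" for j
      by (rule measurable_compose[OF measurable_fst jump_component_measurable[OF that]])
    show ?thesis by measurable
  qed
  also have "?this \<longleftrightarrow> (\<lambda>p. emeasure (case p of (J, \<tau>) \<Rightarrow> normalized_atoms P\<^sub>0 N J \<tau>) B)
      \<in> borel_measurable (jumps N \<Otimes>\<^sub>M sites N)"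
  proof (rule measurable_cong)
    fix p assume p: "p \<in> space (jumps N \<Otimes>\<^sub>M sites N)"
    show "(\<Sum>j=0..N. ennreal (fst p j / (\<Sum>j=0..N. fst p j)) * indicator B (snd p j)) =
        emeasure (case p of (J, \<tau>) \<Rightarrow> normalized_atoms P\<^sub>0 N J \<tau>) B"
      unfolding split_beta
      by (rule emeasure_normalized_atoms[symmetric]) (use p jumps_sites_space B in blast)+
  qed
  finally show "(\<lambda>p. emeasure (case p of (J, \<tau>) \<Rightarrow> normalized_atoms P\<^sub>0 N J \<tau>) B)
      \<in> borel_measurable (jumps N \<Otimes>\<^sub>M sites N)" .
qed

text \<open>
  Integrals against the law of the random measure unfold into the three levels of its
  construction: the Poisson number, the jumps, and the sites.
\<close>

lemma nn_integral_eps_NormCRM: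
  assumes F: "F \<in> borel_measurable (prob_algebra P\<^sub>0)"
  shows "(\<integral>\<^sup>+Q. F Q \<partial>eps_NormCRM \<rho> \<kappa> P\<^sub>0 \<epsilon>) =
    (\<integral>\<^sup>+N. (\<integral>\<^sup>+p. F (normalized_atoms P\<^sub>0 N (fst p) (snd p)) \<partial>(jumps N \<Otimes>\<^sub>M sites N))
      \<partial>measure_pmf (poisson_pmf \<Lambda>))"
proof -
  have pr: "prob_space (jumps N \<Otimes>\<^sub>M sites N)" for N
    using prob_space_jumps prob_space_sites by (rule prob_space_pair)
  let ?K = "\<lambda>N. distr (jumps N \<Otimes>\<^sub>M sites N) (prob_algebra P\<^sub>0)
      (\<lambda>(J, \<tau>). normalized_atoms P\<^sub>0 N J \<tau>)"
  have K: "?K \<in> measure_pmf (poisson_pmf \<Lambda>) \<rightarrow>\<^sub>M subprob_algebra (prob_algebra P\<^sub>0)"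
    by (auto simp: space_subprob_algebra
        intro!: prob_space_imp_subprob_space prob_space.prob_space_distr pr
          normalized_atoms_measurable)
  show ?thesis
    unfolding eps_NormCRM_def nn_integral_bind[OF F K]
    using F
    by (intro nn_integral_cong, subst nn_integral_distr[OF normalized_atoms_measurable])
      (simp_all add: split_beta)
qed

end

section \<open>The law of a sample as a mixture over labellings\<close>

text \<open>
  Integrating the conditional probabilities of a product event over the whole space removes
  the conditioning. Product events determine the law of the sample, so this identity pins it down.
\<close>

lemma (in prob_space) sample_rectangle:
  assumes Q: "random_prob_measure M S Q" and sample: "sample_from M S Q n \<theta>"
    and B: "\<And>i. i \<in> {1..n} \<Longrightarrow> B i \<in> sets S"
  shows "emeasure M {\<omega> \<in> space M. \<forall>i\<in>{1..n}. \<theta> i \<omega> \<in> B i} =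
    (\<integral>\<^sup>+\<omega>. (\<Prod>i=1..n. emeasure (Q \<omega>) (B i)) \<partial>M)"
proof -
  let ?A = "{\<omega> \<in> space M. \<forall>i\<in>{1..n}. \<theta> i \<omega> \<in> B i}"
  let ?F = "sigma_gen M (prob_algebra S) Q"
  have Qm: "Q \<in> M \<rightarrow>\<^sub>M prob_algebra S"
    using Q by (simp add: random_prob_measure_def)
  have \<theta>: "\<theta> i \<in> M \<rightarrow>\<^sub>M S" if "i \<in> {1..n}" for i
    using sample that by (simp add: sample_from_def)
  have A: "?A \<in> sets M"
    using \<theta> B by measurable
  have F: "subalgebra M ?F"
    unfolding subalgebra_def sigma_gen_def
    using Qm by (auto simp: sets_vimage_algebra2 measurable_space)
  interpret finite_measure_subalgebra M ?F
    by unfold_locales (rule F)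
  have Qprob: "prob_space (Q \<omega>)" if "\<omega> \<in> space M" for \<omega>
    using measurable_space[OF Qm that] by (simp add: space_prob_algebra)
  have int: "integrable M (indicator ?A :: _ \<Rightarrow> real)"
    using A by (intro integrable_real_indicator) (auto simp: emeasure_eq_measure)
  have AE: "AE \<omega> in M. real_cond_exp M ?F (indicator ?A) \<omega> = (\<Prod>i=1..n. measure (Q \<omega>) (B i))"
    using sample B unfolding sample_from_def by blast
  have "emeasure M ?A = ennreal (\<integral>\<omega>. indicator ?A \<omega> \<partial>M)"
    using A by (simp add: emeasure_eq_measure)
  also have "(\<integral>\<omega>. indicator ?A \<omega> \<partial>M) = (\<integral>\<omega>. real_cond_exp M ?F (indicator ?A) \<omega> \<partial>M)"
    by (rule real_cond_exp_int(2)[OF int, symmetric])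
  also have "ennreal \<dots> = (\<integral>\<^sup>+\<omega>. ennreal (real_cond_exp M ?F (indicator ?A) \<omega>) \<partial>M)"
  proof (rule nn_integral_eq_integral[symmetric])
    show "integrable M (real_cond_exp M ?F (indicator ?A))"
      by (rule real_cond_exp_int(1)[OF int])
    show "AE \<omega> in M. 0 \<le> real_cond_exp M ?F (indicator ?A) \<omega>"
      using AE by eventually_elim (simp add: prod_nonneg)
  qed
  also have "\<dots> = (\<integral>\<^sup>+\<omega>. ennreal (\<Prod>i=1..n. measure (Q \<omega>) (B i)) \<partial>M)"
    using AE by (intro nn_integral_cong_AE) auto
  also have "\<dots> = (\<integral>\<^sup>+\<omega>. (\<Prod>i=1..n. emeasure (Q \<omega>) (B i)) \<partial>M)"
  proof (rule nn_integral_cong)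
    fix \<omega> assume "\<omega> \<in> space M"
    then interpret Q: prob_space "Q \<omega>" by (rule Qprob)
    show "ennreal (\<Prod>i=1..n. measure (Q \<omega>) (B i)) = (\<Prod>i=1..n. emeasure (Q \<omega>) (B i))"
      by (simp add: Q.emeasure_eq_measure prod_ennreal)
  qed
  finally show ?thesis .
qed

context normalized_crm begin

text \<open>
  The probability that the sampled indices \<open>1, \<dots>, n\<close> choose the atoms \<open>f 1, \<dots>, f n\<close>, given that
  there are \<open>N + 1\<close> atoms.
\<close>

definition label_weight :: "nat \<Rightarrow> nat \<Rightarrow> (nat \<Rightarrow> nat) \<Rightarrow> ennreal" where
  "label_weight n N f = (\<integral>\<^sup>+x. (\<Prod>i=1..n. ennreal (x (f i) / (\<Sum>j=0..N. x j))) \<partial>jumps N)"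

definition labelled_sites :: "nat \<Rightarrow> nat \<Rightarrow> (nat \<Rightarrow> nat) \<Rightarrow> (nat \<Rightarrow> 'a) measure" where
  "labelled_sites n N f =
     distr (sites N) (\<Pi>\<^sub>M i\<in>{1..n}. P\<^sub>0) (\<lambda>\<tau>. \<lambda>i\<in>{1..n}. \<tau> (f i))"

lemma relabel_measurable:
  assumes "f \<in> {1..n} \<rightarrow>\<^sub>E {0..N}"
  shows "(\<lambda>\<tau>. \<lambda>i\<in>{1..n}. \<tau> (f i)) \<in> sites N \<rightarrow>\<^sub>M (\<Pi>\<^sub>M i\<in>{1..n}. P\<^sub>0)"
  by (intro measurable_restrict measurable_component_singleton) (use assms in auto)

lemma prob_space_labelled_sites:
  "f \<in> {1..n} \<rightarrow>\<^sub>E {0..N} \<Longrightarrow> prob_space (labelled_sites n N f)"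
  unfolding labelled_sites_def
  by (intro prob_space.prob_space_distr prob_space_sites relabel_measurable)

text \<open>
  Expanding a product of \<open>n\<close> sums over the atoms produces one summand for each labelling. In each
  summand the jumps and the sites separate, and they are independent.
\<close>

lemma rectangle_given_size:
  assumes B [measurable]: "\<And>i. i \<in> {1..n} \<Longrightarrow> B i \<in> sets P\<^sub>0"
  shows "(\<integral>\<^sup>+p. (\<Prod>i=1..n. emeasure (normalized_atoms P\<^sub>0 N (fst p) (snd p)) (B i))
        \<partial>(jumps N \<Otimes>\<^sub>M sites N)) =
    (\<Sum>f\<in>{1..n} \<rightarrow>\<^sub>E {0..N}. label_weight n N f * emeasure (labelled_sites n N f) (Pi\<^sub>E {1..n} B))"
proof -
  interpret sites: prob_space "sites N" by (rule prob_space_sites)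
  let ?F = "{1..n} \<rightarrow>\<^sub>E {0..N}"
  let ?w = "\<lambda>f x. \<Prod>i=1..n. ennreal (x (f i) / (\<Sum>j=0..N. x j))"
  let ?A = "\<lambda>f \<tau>. indicator (Pi\<^sub>E {1..n} B) (\<lambda>i\<in>{1..n}. \<tau> (f i)) :: ennreal"
  have jc [measurable]: "(\<lambda>x. x j) \<in> borel_measurable (jumps N)" if "j \<in> {0..N}" for j
    using that by (rule jump_component_measurable)
  have w [measurable]: "?w f \<in> borel_measurable (jumps N)" if "f \<in> ?F" for f
  proof -
    have "(\<lambda>x. x (f i)) \<in> borel_measurable (jumps N)" if "i \<in> {1..n}" for i
      using \<open>f \<in> ?F\<close> that by (intro jc) auto
    then show ?thesis by measurable
  qed
  have rect: "Pi\<^sub>E {1..n} B \<in> sets (\<Pi>\<^sub>M i\<in>{1..n}. P\<^sub>0)"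
    by (intro sets_PiM_I_finite) (auto intro: B)
  have A [measurable]: "?A f \<in> borel_measurable (sites N)" if "f \<in> ?F" for f
    by (rule measurable_compose[OF relabel_measurable[OF that] borel_measurable_indicator[OF rect]])
  have wA: "(\<lambda>p. ?w f (fst p) * ?A f (snd p)) \<in> borel_measurable (jumps N \<Otimes>\<^sub>M sites N)"
    if "f \<in> ?F" for f
    using measurable_compose[OF measurable_fst w[OF that]]
      measurable_compose[OF measurable_snd A[OF that]]
    by (rule borel_measurable_times_ennreal)
  have "(\<integral>\<^sup>+p. (\<Prod>i=1..n. emeasure (normalized_atoms P\<^sub>0 N (fst p) (snd p)) (B i))
        \<partial>(jumps N \<Otimes>\<^sub>M sites N)) =
      (\<integral>\<^sup>+p. (\<Sum>f\<in>?F. ?w f (fst p) * ?A f (snd p)) \<partial>(jumps N \<Otimes>\<^sub>M sites N))"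
  proof (rule nn_integral_cong)
    fix p assume p: "p \<in> space (jumps N \<Otimes>\<^sub>M sites N)"
    have "(\<Prod>i=1..n. emeasure (normalized_atoms P\<^sub>0 N (fst p) (snd p)) (B i)) =
        (\<Prod>i=1..n. \<Sum>j=0..N. ennreal (fst p j / (\<Sum>j=0..N. fst p j)) * indicator (B i) (snd p j))"
      by (intro prod.cong refl emeasure_normalized_atoms) (use p jumps_sites_space B in blast)+
    also have "\<dots> = (\<Sum>f\<in>?F. \<Prod>i=1..n.
        ennreal (fst p (f i) / (\<Sum>j=0..N. fst p j)) * indicator (B i) (snd p (f i)))"
      by (rule prod_sum_PiE) auto
    also have "\<dots> = (\<Sum>f\<in>?F. ?w f (fst p) * ?A f (snd p))"
    proof (intro sum.cong refl)
      fix f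
      have "(\<Prod>i=1..n. indicator (B i) (snd p (f i)) :: ennreal) = ?A f (snd p)"
      proof (cases "\<forall>i\<in>{1..n}. snd p (f i) \<in> B i")
        case True
        then show ?thesis by (auto simp: PiE_iff intro!: prod.neutral)
      next
        case False
        then obtain i where i: "i \<in> {1..n}" "snd p (f i) \<notin> B i" by blast
        then have "(\<Prod>i=1..n. indicator (B i) (snd p (f i)) :: ennreal) = 0"
          by (intro prod_zero) (auto intro!: bexI[of _ i])
        moreover have "(\<lambda>i\<in>{1..n}. snd p (f i)) \<notin> Pi\<^sub>E {1..n} B"
          using i by (auto simp: PiE_iff)
        ultimately show ?thesis by simp
      qed
      then show "(\<Prod>i=1..n. ennreal (fst p (f i) / (\<Sum>j=0..N. fst p j)) *
          indicator (B i) (snd p (f i))) = ?w f (fst p) * ?A f (snd p)"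
        by (simp add: prod.distrib)
    qed
    finally show "(\<Prod>i=1..n. emeasure (normalized_atoms P\<^sub>0 N (fst p) (snd p)) (B i)) =
        (\<Sum>f\<in>?F. ?w f (fst p) * ?A f (snd p))" .
  qed
  also have "\<dots> = (\<Sum>f\<in>?F. \<integral>\<^sup>+p. ?w f (fst p) * ?A f (snd p) \<partial>(jumps N \<Otimes>\<^sub>M sites N))"
    by (rule nn_integral_sum) (rule wA)
  also have "\<dots> = (\<Sum>f\<in>?F. label_weight n N f *
      emeasure (labelled_sites n N f) (Pi\<^sub>E {1..n} B))"
  proof (intro sum.cong refl)
    fix f assume f: "f \<in> ?F"
    have "(\<integral>\<^sup>+p. ?w f (fst p) * ?A f (snd p) \<partial>(jumps N \<Otimes>\<^sub>M sites N)) =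
        (\<integral>\<^sup>+x. (\<integral>\<^sup>+\<tau>. ?w f x * ?A f \<tau> \<partial>sites N) \<partial>jumps N)"
      by (subst sites.nn_integral_fst[OF wA[OF f], symmetric]) simp
    also have "\<dots> = (\<integral>\<^sup>+x. ?w f x * (\<integral>\<^sup>+\<tau>. ?A f \<tau> \<partial>sites N) \<partial>jumps N)"
      by (intro nn_integral_cong nn_integral_cmult A f)
    also have "\<dots> = label_weight n N f * (\<integral>\<^sup>+\<tau>. ?A f \<tau> \<partial>sites N)"
      unfolding label_weight_def by (intro nn_integral_multc w f)
    also have "(\<integral>\<^sup>+\<tau>. ?A f \<tau> \<partial>sites N) =
        (\<integral>\<^sup>+y. indicator (Pi\<^sub>E {1..n} B) y \<partial>labelled_sites n N f)"
      unfolding labelled_sites_def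
      by (rule nn_integral_distr[OF relabel_measurable[OF f], symmetric]) (use rect in simp)
    also have "\<dots> = emeasure (labelled_sites n N f) (Pi\<^sub>E {1..n} B)"
      using rect by (intro nn_integral_indicator) (simp add: labelled_sites_def)
    finally show "(\<integral>\<^sup>+p. ?w f (fst p) * ?A f (snd p) \<partial>(jumps N \<Otimes>\<^sub>M sites N)) =
        label_weight n N f * emeasure (labelled_sites n N f) (Pi\<^sub>E {1..n} B)" .
  qed
  finally show ?thesis .
qed

text \<open>
  The law of the sample, written as a mixture over all pairs of a number \<open>N\<close> and a labelling
  \<open>f\<close>. It has to be a measure, and not just a formula for product events, in order that two
  measures can be compared on the generator. The null measure is only a default value outside
  the range of labellings, where the mixing density vanishes.
\<close>

definition label_mixture :: "nat \<Rightarrow> (nat \<Rightarrow> 'a) measure" where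
  "label_mixture n =
     density (count_space UNIV)
       (\<lambda>(N, f). ennreal (pmf (poisson_pmf \<Lambda>) N) *
          (label_weight n N f * indicator ({1..n} \<rightarrow>\<^sub>E {0..N}) f))
     \<bind> (\<lambda>(N, f). if f \<in> {1..n} \<rightarrow>\<^sub>E {0..N} then labelled_sites n N f
          else null_measure (\<Pi>\<^sub>M i\<in>{1..n}. P\<^sub>0))"

lemma label_mixture:
  shows sets_label_mixture: "sets (label_mixture n) = sets (\<Pi>\<^sub>M i\<in>{1..n}. P\<^sub>0)" (is ?sets)
    and emeasure_label_mixture: "A \<in> sets (\<Pi>\<^sub>M i\<in>{1..n}. P\<^sub>0) \<Longrightarrow>
      emeasure (label_mixture n) A =
        (\<integral>\<^sup>+N. (\<Sum>f\<in>{1..n} \<rightarrow>\<^sub>E {0..N}. label_weight n N f * emeasure (labelled_sites n N f) A)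
          \<partial>measure_pmf (poisson_pmf \<Lambda>))" (is "_ \<Longrightarrow> ?em")
proof -
  let ?P = "\<Pi>\<^sub>M i\<in>{1..n}. P\<^sub>0"
  let ?a = "\<lambda>(N, f). ennreal (pmf (poisson_pmf \<Lambda>) N) *
          (label_weight n N f * indicator ({1..n} \<rightarrow>\<^sub>E {0..N}) f)"
  let ?D = "density (count_space UNIV) ?a"
  let ?K = "\<lambda>(N, f). if f \<in> {1..n} \<rightarrow>\<^sub>E {0..N} then labelled_sites n N f else null_measure ?P"
  have K: "?K \<in> ?D \<rightarrow>\<^sub>M subprob_algebra ?P"
  proof -
    have "?K \<in> count_space UNIV \<rightarrow>\<^sub>M subprob_algebra ?P"
    proof -
      have "?K z \<in> space (subprob_algebra ?P)" for z
      proof (cases "snd z \<in> {1..n} \<rightarrow>\<^sub>E {0..fst z}")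
        case True
        then show ?thesis
          using prob_space_imp_subprob_space[OF prob_space_labelled_sites[OF True]]
          by (simp add: split_beta space_subprob_algebra) (simp add: labelled_sites_def)
      next
        case False
        then show ?thesis
          by (auto simp: split_beta space_PiM PiE_eq_empty_iff P0.not_empty)
      qed
      then show ?thesis by auto
    qed
    moreover have "?D \<rightarrow>\<^sub>M subprob_algebra ?P = count_space UNIV \<rightarrow>\<^sub>M subprob_algebra ?P"
      by (intro measurable_cong_sets) auto
    ultimately show ?thesis by simp
  qed
  have ne: "space ?D \<noteq> {}" by simp
  show ?sets
    unfolding label_mixture_def by (rule sets_bind[OF _ ne]) (use sets_kernel[OF K] in simp)
  show ?em if A: "A \<in> sets ?P"
  proof -
    let ?g = "\<lambda>N f. ennreal (pmf (poisson_pmf \<Lambda>) N) *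
        (label_weight n N f * indicator ({1..n} \<rightarrow>\<^sub>E {0..N}) f) * emeasure (?K (N, f)) A"
    have "emeasure (label_mixture n) A = (\<integral>\<^sup>+z. emeasure (?K z) A \<partial>?D)"
      unfolding label_mixture_def by (rule emeasure_bind[OF ne K A])
    also have "\<dots> = (\<integral>\<^sup>+z. ?a z * emeasure (?K z) A \<partial>count_space UNIV)"
      by (rule nn_integral_density) auto
    also have "\<dots> = (\<integral>\<^sup>+N. \<integral>\<^sup>+f. ?g N f \<partial>count_space UNIV \<partial>count_space UNIV)"
      by (subst nn_integral_fst_count_space[symmetric]) simp
    also have "\<dots> = (\<integral>\<^sup>+N. ennreal (pmf (poisson_pmf \<Lambda>) N) *
        (\<Sum>f\<in>{1..n} \<rightarrow>\<^sub>E {0..N}. label_weight n N f * emeasure (labelled_sites n N f) A)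
          \<partial>count_space UNIV)"
    proof (rule nn_integral_cong)
      fix N
      have "(\<integral>\<^sup>+f. ?g N f \<partial>count_space UNIV) = (\<Sum>f\<in>{1..n} \<rightarrow>\<^sub>E {0..N}. ?g N f)"
        by (rule nn_integral_count_space'[OF finite_PiE]) auto
      also have "\<dots> = (\<Sum>f\<in>{1..n} \<rightarrow>\<^sub>E {0..N}. ennreal (pmf (poisson_pmf \<Lambda>) N) *
          (label_weight n N f * emeasure (labelled_sites n N f) A))"
        by (intro sum.cong) (simp_all add: mult.assoc)
      finally show "(\<integral>\<^sup>+f. ?g N f \<partial>count_space UNIV) = ennreal (pmf (poisson_pmf \<Lambda>) N) *
        (\<Sum>f\<in>{1..n} \<rightarrow>\<^sub>E {0..N}. label_weight n N f * emeasure (labelled_sites n N f) A)"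
        by (simp add: sum_distrib_left)
    qed
    also have "\<dots> = (\<integral>\<^sup>+N. (\<Sum>f\<in>{1..n} \<rightarrow>\<^sub>E {0..N}.
        label_weight n N f * emeasure (labelled_sites n N f) A) \<partial>measure_pmf (poisson_pmf \<Lambda>))"
      by (rule nn_integral_measure_pmf[symmetric])
    finally show ?thesis .
  qed
qed

text \<open>
  Both sides are finite measures that agree on products of measurable sets, by the two
  expansions above.
\<close>

lemma sample_law:
  assumes "prob_space M" and Q: "random_prob_measure M P\<^sub>0 Q"
    and law: "distr M (prob_algebra P\<^sub>0) Q = eps_NormCRM \<rho> \<kappa> P\<^sub>0 \<epsilon>"
    and sample: "sample_from M P\<^sub>0 Q n \<theta>"
  shows "distr M (\<Pi>\<^sub>M i\<in>{1..n}. P\<^sub>0) (\<lambda>\<omega>. \<lambda>i\<in>{1..n}. \<theta> i \<omega>) = label_mixture n"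
proof -
  interpret M: prob_space M by fact
  let ?P = "\<Pi>\<^sub>M i\<in>{1..n}. P\<^sub>0"
  let ?X = "\<lambda>\<omega>. \<lambda>i\<in>{1..n}. \<theta> i \<omega>"
  have X: "?X \<in> M \<rightarrow>\<^sub>M ?P"
    using sample by (intro measurable_restrict) (simp add: sample_from_def)
  have Qm: "Q \<in> M \<rightarrow>\<^sub>M prob_algebra P\<^sub>0"
    using Q by (simp add: random_prob_measure_def)
  show ?thesis
  proof (rule measure_eqI_PiM_finite[where I = "{1..n}" and M = "\<lambda>_. P\<^sub>0"
        and A = "\<lambda>_::nat. space ?P"])
    fix B :: "nat \<Rightarrow> 'a set"
    assume B: "\<And>i. i \<in> {1..n} \<Longrightarrow> B i \<in> sets P\<^sub>0"
    have rect: "Pi\<^sub>E {1..n} B \<in> sets ?P"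
      by (intro sets_PiM_I_finite) (auto intro: B)
    have F: "(\<lambda>q. \<Prod>i=1..n. emeasure q (B i)) \<in> borel_measurable (prob_algebra P\<^sub>0)"
      unfolding prob_algebra_def
      by (intro measurable_restrict_space1 borel_measurable_prod_ennreal
          measurable_emeasure_subprob_algebra B)
    have "emeasure (distr M ?P ?X) (Pi\<^sub>E {1..n} B) =
        emeasure M {\<omega> \<in> space M. \<forall>i\<in>{1..n}. \<theta> i \<omega> \<in> B i}"
      unfolding emeasure_distr[OF X rect]
      by (intro arg_cong[where f = "emeasure M"]) (auto simp: PiE_iff)
    also have "\<dots> = (\<integral>\<^sup>+\<omega>. (\<Prod>i=1..n. emeasure (Q \<omega>) (B i)) \<partial>M)"
      by (rule M.sample_rectangle[OF Q sample B])
    also have "\<dots> = (\<integral>\<^sup>+q. (\<Prod>i=1..n. emeasure q (B i)) \<partial>eps_NormCRM \<rho> \<kappa> P\<^sub>0 \<epsilon>)"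
      unfolding law[symmetric] using F by (subst nn_integral_distr[OF Qm]) simp_all
    also have "\<dots> = emeasure (label_mixture n) (Pi\<^sub>E {1..n} B)"
      unfolding nn_integral_eps_NormCRM[OF F] emeasure_label_mixture[OF rect]
      by (intro nn_integral_cong rectangle_given_size B)
    finally show "emeasure (distr M ?P ?X) (Pi\<^sub>E {1..n} B) =
        emeasure (label_mixture n) (Pi\<^sub>E {1..n} B)" .
  next
    interpret D: prob_space "distr M ?P ?X"
      by (rule M.prob_space_distr[OF X])
    show "emeasure (distr M ?P ?X) (space ?P) \<noteq> \<infinity>"
      using D.emeasure_space_1 by simp
    show "range (\<lambda>_::nat. space ?P) \<subseteq> prod_algebra {1..n} (\<lambda>_. P\<^sub>0)"
      by (auto simp: space_PiM intro!: prod_algebraI_finite)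
  qed (auto simp: sets_label_mixture)
qed

end

section \<open>Counting labellings with prescribed ties\<close>

text \<open>
  The image of a new point can be chosen freely, and it is then excluded for all other points.
  Truncated subtraction makes the product vanish when there is no injection.
\<close>

lemma card_injections:
  assumes "finite A" "finite B"
  shows "card {g \<in> A \<rightarrow>\<^sub>E B. inj_on g A} = (\<Prod>i<card A. card B - i)"
  using assms
proof (induction A arbitrary: B rule: finite_induct)
  case empty
  then show ?case by simp
next
  case (insert a A)
  let ?G = "\<lambda>y. {g \<in> A \<rightarrow>\<^sub>E (B - {y}). inj_on g A}"
  have "{g \<in> insert a A \<rightarrow>\<^sub>E B. inj_on g (insert a A)} = (\<lambda>(y, g). g(a := y)) ` (SIGMA y:B. ?G y)"
    using extensional_funcset_extend_domain_inj_on_eq[OF insert.hyps(2), of B]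
    by (simp add: Sigma_def Collect_case_prod_Sigma set_eq_iff image_iff)
  moreover have "inj_on (\<lambda>(y, g). g(a := y)) (SIGMA y:B. ?G y)"
    by (rule inj_on_subset[OF extensional_funcset_extend_domain_inj_onI[OF insert.hyps(2), of B]])
      auto
  ultimately have "card {g \<in> insert a A \<rightarrow>\<^sub>E B. inj_on g (insert a A)} = card (SIGMA y:B. ?G y)"
    by (simp add: card_image)
  also have "\<dots> = (\<Sum>y\<in>B. card (?G y))"
  proof (intro card_SigmaI ballI)
    show "finite (?G y)" for y
      by (rule finite_subset[of _ "A \<rightarrow>\<^sub>E (B - {y})"])
        (use insert.prems insert.hyps in \<open>auto intro!: finite_PiE\<close>)
  qed (use insert.prems in simp)
  also have "\<dots> = (\<Sum>y\<in>B. \<Prod>i<card A. card B - Suc i)"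
    using insert.prems by (intro sum.cong refl) (simp add: insert.IH)
  also have "\<dots> = (\<Prod>i<card (insert a A). card B - i)"
    using insert.hyps by (simp add: prod.lessThan_Suc_shift del: prod.lessThan_Suc)
  finally show ?case .
qed

lemma falling_product_times_fact: "(\<Prod>i<k. m + k - i) * fact m = (fact (m + k) :: nat)"
proof (induction k)
  case (Suc k)
  have "(\<Prod>i<Suc k. m + Suc k - i) = (m + Suc k) * (\<Prod>i<k. m + k - i)"
    by (simp add: prod.lessThan_Suc_shift del: prod.lessThan_Suc)
  then show ?case using Suc.IH by (simp add: algebra_simps)
qed simp

text \<open>
  The falling product with \<open>k\<close> factors starts at \<open>N + 1\<close>, not at \<open>N\<close>, since there is one atom
  more than the Poisson count. Substituting \<open>N + 1 = m + k\<close>, the factor \<open>1 / fact N\<close> therefore leaves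
  \<open>(m + k) / fact m\<close>, and the series is that of \<open>y * exp y + k * exp y\<close>.
\<close>

lemma poisson_factorial_moment_series:
  fixes \<Lambda> y :: real
  assumes "\<Lambda> > 0" "k \<ge> 1"
  shows "(\<lambda>N. pmf (poisson_pmf \<Lambda>) N * real (\<Prod>i<k. N + 1 - i) * (y / \<Lambda>) ^ (N + 1 - k))
    sums (exp (- \<Lambda>) * \<Lambda> ^ (k - 1) * ((real k + y) * exp y))"
proof -
  let ?t = "\<lambda>N. pmf (poisson_pmf \<Lambda>) N * real (\<Prod>i<k. N + 1 - i) * (y / \<Lambda>) ^ (N + 1 - k)"
  have e: "(\<lambda>m. y ^ m / fact m) sums exp y"
    using exp_converges[of y] by (simp add: divide_inverse mult.commute)
  have "(\<lambda>m. real (Suc m) * y ^ Suc m / fact (Suc m)) sums (y * exp y)"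
  proof -
    have "(\<lambda>m. real (Suc m) * y ^ Suc m / fact (Suc m)) = (\<lambda>m. y * (y ^ m / fact m))"
      by (rule ext) (simp add: divide_simps del: of_nat_Suc)
    then show ?thesis using sums_mult[OF e, of y] by simp
  qed
  then have "(\<lambda>m. real m * y ^ m / fact m) sums (y * exp y)"
    by (subst (asm) sums_Suc_iff) simp
  from sums_add[OF sums_mult[OF e, of "real k"] this]
  have "(\<lambda>m. real (k + m) * (y ^ m / fact m)) sums ((real k + y) * exp y)"
    by (simp add: algebra_simps add_divide_distrib)
  then have "(\<lambda>m. exp (- \<Lambda>) * \<Lambda> ^ (k - 1) * (real (k + m) * (y ^ m / fact m)))
      sums (exp (- \<Lambda>) * \<Lambda> ^ (k - 1) * ((real k + y) * exp y))"
    by (rule sums_mult)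
  also have "(\<lambda>m. exp (- \<Lambda>) * \<Lambda> ^ (k - 1) * (real (k + m) * (y ^ m / fact m))) =
      (\<lambda>m. ?t (m + (k - 1)))"
  proof (rule ext)
    fix m
    have k: "m + (k - 1) + 1 = m + k" using assms by simp
    have "real (\<Prod>i<k. m + k - i) * fact m = real (fact (m + k))"
      by (metis falling_product_times_fact of_nat_fact of_nat_mult)
    also have "fact (m + k) = (m + k) * (fact (m + (k - 1)) :: nat)"
      using fact_Suc[of "m + (k - 1)", where ?'a = nat] k by simp
    finally have P: "real (\<Prod>i<k. m + k - i) = real (m + k) * fact (m + (k - 1)) / fact m"
      by (simp add: field_simps)
    have "?t (m + (k - 1)) = \<Lambda> ^ (m + (k - 1)) / fact (m + (k - 1)) * exp (- \<Lambda>) *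
        (real (m + k) * fact (m + (k - 1)) / fact m) * (y / \<Lambda>) ^ m"
      unfolding k P using assms by simp
    also have "\<dots> = exp (- \<Lambda>) * \<Lambda> ^ (k - 1) * (real (k + m) * (y ^ m / fact m))"
      unfolding power_add[of \<Lambda>] power_divide using assms by (simp add: field_simps)
    finally show "exp (- \<Lambda>) * \<Lambda> ^ (k - 1) * (real (k + m) * (y ^ m / fact m)) = ?t (m + (k - 1))" ..
  qed
  finally show ?thesis
  proof (subst (asm) sums_zero_iff_shift)
    \<comment> \<open>The first \<open>k - 1\<close> terms vanish: fewer than \<open>k\<close> atoms are available.\<close>
    fix N assume "N < k - 1"
    then have "(\<Prod>i<k. N + 1 - i) = 0"
      by (intro prod_zero) (auto intro!: bexI[of _ "N + 1"])
    then show "?t N = 0" by simp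
  qed
qed

locale indexed_partition =
  fixes n k :: nat and C :: "nat \<Rightarrow> nat set"
  assumes part: "partition_on {1..n} (C ` {1..k})" and inj_C: "inj_on C {1..k}"
begin

definition block :: "nat \<Rightarrow> nat" where
  "block i = (THE l. l \<in> {1..k} \<and> i \<in> C l)"

lemma block_unique: "l \<in> {1..k} \<Longrightarrow> i \<in> C l \<Longrightarrow> block i = l"
  unfolding block_def
proof (rule the_equality)
  fix l' assume "l \<in> {1..k}" "i \<in> C l" "l' \<in> {1..k} \<and> i \<in> C l'"
  then have "C l = C l'"
    using partition_onD2[OF part] unfolding disjoint_def by blast
  then show "l' = l"
    using inj_C \<open>l \<in> {1..k}\<close> \<open>l' \<in> {1..k} \<and> i \<in> C l'\<close> by (auto dest: inj_onD)
qed blast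

lemma block_mem: assumes "i \<in> {1..n}" shows "block i \<in> {1..k}" "i \<in> C (block i)"
proof -
  obtain l where l: "l \<in> {1..k}" "i \<in> C l"
    using assms unfolding partition_onD1[OF part] by blast
  with block_unique[OF l] show "block i \<in> {1..k}" "i \<in> C (block i)" by auto
qed

lemma C_eq_block_fibre: assumes "l \<in> {1..k}" shows "C l = {i \<in> {1..n}. block i = l}"
proof
  show "C l \<subseteq> {i \<in> {1..n}. block i = l}"
    using assms partition_onD1[OF part] block_unique[OF assms] by auto
  show "{i \<in> {1..n}. block i = l} \<subseteq> C l"
    using block_mem by auto
qed

lemma C_nonempty: "l \<in> {1..k} \<Longrightarrow> C l \<noteq> {}"
  using partition_onD3[OF part] by auto

text \<open>
  Replaces equality of set partitions by a condition on pairs of indices. This condition is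
  visibly measurable, and it is visibly invariant under injective relabelling.
\<close>

lemma tie_partition_eq_iff:
  "tie_partition n x = C ` {1..k} \<longleftrightarrow>
     (\<forall>i\<in>{1..n}. \<forall>j\<in>{1..n}. x i = x j \<longleftrightarrow> block i = block j)"
proof -
  let ?R = "{(i, j). i \<in> {1..n} \<and> j \<in> {1..n} \<and> x i = x j}"
  have cls: "?R `` {i} = {j \<in> {1..n}. x i = x j}" if "i \<in> {1..n}" for i
    using that by auto
  show ?thesis
  proof (rule iffI; (intro ballI)?)
    fix i j
    assume eq: "tie_partition n x = C ` {1..k}" and i: "i \<in> {1..n}" and j: "j \<in> {1..n}"
    have "?R `` {i} \<in> C ` {1..k}"
      using i eq[symmetric] unfolding tie_partition_def by (auto simp: quotient_def)
    then obtain l where l: "l \<in> {1..k}" "{j \<in> {1..n}. x i = x j} = C l"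
      unfolding cls[OF i] by auto
    moreover have "i \<in> C l" using l(2) i by auto
    ultimately have "{j \<in> {1..n}. x i = x j} = C (block i)"
      using block_unique by auto
    then have "x i = x j \<longleftrightarrow> j \<in> C (block i)" using j by auto
    then show "x i = x j \<longleftrightarrow> block i = block j"
      using block_unique block_mem i j by metis
  next
    assume H: "\<forall>i\<in>{1..n}. \<forall>j\<in>{1..n}. x i = x j \<longleftrightarrow> block i = block j"
    have *: "?R `` {i} = C (block i)" if "i \<in> {1..n}" for i
      unfolding cls[OF that] C_eq_block_fibre[OF block_mem(1)[OF that]]
      using H that by fastforce
    have "block ` {1..n} = {1..k}"
    proof
      show "{1..k} \<subseteq> block ` {1..n}"
      proof
        fix l assume "l \<in> {1..k}"
        then obtain i where "i \<in> {1..n}" "block i = l"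
          using C_nonempty C_eq_block_fibre by blast
        then show "l \<in> block ` {1..n}" by blast
      qed
    qed (use block_mem in auto)
    then have "C ` {1..k} = (\<lambda>i. ?R `` {i}) ` {1..n}"
      using * by (simp add: image_image flip: image_image[of C block])
    then show "tie_partition n x = C ` {1..k}"
      unfolding tie_partition_def quotient_def by auto
  qed
qed

definition labellings :: "nat \<Rightarrow> (nat \<Rightarrow> nat) set" where
  "labellings N = {f \<in> {1..n} \<rightarrow>\<^sub>E {0..N}. tie_partition n f = C ` {1..k}}"

text \<open>
  Such a labelling is constant on blocks and separates them, so it is the same as an injective
  choice of an atom for each block.
\<close>

lemma labellings_bij_injections:
  "bij_betw (\<lambda>g. \<lambda>i\<in>{1..n}. g (block i)) {g \<in> {1..k} \<rightarrow>\<^sub>E {0..N}. inj_on g {1..k}} (labellings N)"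
proof (rule bij_betw_byWitness[where f' = "\<lambda>f. \<lambda>l\<in>{1..k}. f (SOME i. i \<in> C l)"])
  have some: "(SOME i. i \<in> C l) \<in> {1..n}" "block (SOME i. i \<in> C l) = l" if "l \<in> {1..k}" for l
    using some_in_eq[of "C l"] C_nonempty[OF that] C_eq_block_fibre[OF that] by auto
  show "\<forall>g\<in>{g \<in> {1..k} \<rightarrow>\<^sub>E {0..N}. inj_on g {1..k}}.
      (\<lambda>l\<in>{1..k}. (\<lambda>i\<in>{1..n}. g (block i)) (SOME i. i \<in> C l)) = g"
    using some by (auto simp: fun_eq_iff restrict_def PiE_iff extensional_def)
  show "\<forall>f\<in>labellings N. (\<lambda>i\<in>{1..n}. (\<lambda>l\<in>{1..k}. f (SOME i. i \<in> C l)) (block i)) = f"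
  proof (intro ballI ext)
    fix f i assume f: "f \<in> labellings N"
    show "(\<lambda>i\<in>{1..n}. (\<lambda>l\<in>{1..k}. f (SOME i. i \<in> C l)) (block i)) i = f i"
    proof (cases "i \<in> {1..n}")
      case True
      then have "f (SOME i'. i' \<in> C (block i)) = f i"
        using f some[OF block_mem(1)[OF True]] unfolding labellings_def tie_partition_eq_iff by blast
      then show ?thesis using True block_mem by simp
    next
      case False
      then show ?thesis using f by (auto simp: labellings_def PiE_iff extensional_def)
    qed
  qed
  show "(\<lambda>g. \<lambda>i\<in>{1..n}. g (block i)) ` {g \<in> {1..k} \<rightarrow>\<^sub>E {0..N}. inj_on g {1..k}} \<subseteq> labellings N"
  proof
    fix f assume "f \<in> (\<lambda>g. \<lambda>i\<in>{1..n}. g (block i)) ` {g \<in> {1..k} \<rightarrow>\<^sub>E {0..N}. inj_on g {1..k}}"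
    then obtain g where g: "g \<in> {1..k} \<rightarrow>\<^sub>E {0..N}" "inj_on g {1..k}"
      and f: "f = (\<lambda>i\<in>{1..n}. g (block i))" by blast
    have "f \<in> {1..n} \<rightarrow>\<^sub>E {0..N}"
      unfolding f using g(1) block_mem by (auto simp: PiE_iff)
    then show "f \<in> labellings N"
      unfolding labellings_def tie_partition_eq_iff f
      using inj_on_eq_iff[OF g(2)] block_mem by auto
  qed
  show "(\<lambda>f. \<lambda>l\<in>{1..k}. f (SOME i. i \<in> C l)) ` labellings N
      \<subseteq> {g \<in> {1..k} \<rightarrow>\<^sub>E {0..N}. inj_on g {1..k}}"
  proof
    fix g assume "g \<in> (\<lambda>f. \<lambda>l\<in>{1..k}. f (SOME i. i \<in> C l)) ` labellings N"
    then obtain f where f: "f \<in> labellings N" and g: "g = (\<lambda>l\<in>{1..k}. f (SOME i. i \<in> C l))"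
      by blast
    have "g \<in> {1..k} \<rightarrow>\<^sub>E {0..N}"
      using f some(1) unfolding g labellings_def by (auto simp: PiE_iff)
    moreover have "inj_on g {1..k}"
    proof (rule inj_onI)
      fix l l' assume l: "l \<in> {1..k}" "l' \<in> {1..k}" "g l = g l'"
      then have "f (SOME i. i \<in> C l) = f (SOME i. i \<in> C l')" unfolding g by simp
      then have "block (SOME i. i \<in> C l) = block (SOME i. i \<in> C l')"
        using f some[OF l(1)] some[OF l(2)] unfolding labellings_def tie_partition_eq_iff by blast
      then show "l = l'" using some l by simp
    qed
    ultimately show "g \<in> {g \<in> {1..k} \<rightarrow>\<^sub>E {0..N}. inj_on g {1..k}}" by blast
  qed
qed

lemma card_labellings: "card (labellings N) = (\<Prod>i<k. N + 1 - i)"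
  using bij_betw_same_card[OF labellings_bij_injections[of N]]
    card_injections[of "{1..k}" "{0..N}"] by simp

text \<open>
  The \<open>k\<close> atoms chosen by the blocks occur as often as the blocks are large, and each of the
  remaining \<open>N + 1 - k\<close> atoms does not occur at all.
\<close>

lemma prod_labelling:
  fixes \<phi> :: "nat \<Rightarrow> 'b :: comm_monoid_mult"
  assumes "f \<in> labellings N"
  shows "(\<Prod>j=0..N. \<phi> (card {i \<in> {1..n}. f i = j})) =
    (\<Prod>l=1..k. \<phi> (card (C l))) * \<phi> 0 ^ (N + 1 - k)"
proof -
  obtain g where g: "g \<in> {1..k} \<rightarrow>\<^sub>E {0..N}" "inj_on g {1..k}"
    and f: "f = (\<lambda>i\<in>{1..n}. g (block i))"
    using assms labellings_bij_injections[of N] unfolding bij_betw_def by blast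
  have occ: "{i \<in> {1..n}. f i = g l} = C l" if "l \<in> {1..k}" for l
    unfolding C_eq_block_fibre[OF that] f
    using inj_on_eq_iff[OF g(2)] block_mem that by auto
  have unocc: "{i \<in> {1..n}. f i = j} = {}" if "j \<notin> g ` {1..k}" for j
    using that block_mem(1) unfolding f by auto
  have sub: "g ` {1..k} \<subseteq> {0..N}" using g(1) by auto
  have "(\<Prod>j=0..N. \<phi> (card {i \<in> {1..n}. f i = j})) =
      (\<Prod>j\<in>{0..N} - g ` {1..k}. \<phi> (card {i \<in> {1..n}. f i = j})) *
      (\<Prod>j\<in>g ` {1..k}. \<phi> (card {i \<in> {1..n}. f i = j}))"
    by (rule prod.subset_diff[OF sub]) simp
  also have "(\<Prod>j\<in>{0..N} - g ` {1..k}. \<phi> (card {i \<in> {1..n}. f i = j})) =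
      (\<Prod>j\<in>{0..N} - g ` {1..k}. \<phi> 0)"
  proof (intro prod.cong refl)
    fix j assume "j \<in> {0..N} - g ` {1..k}"
    then have "{i \<in> {1..n}. f i = j} = {}" by (intro unocc) simp
    then show "\<phi> (card {i \<in> {1..n}. f i = j}) = \<phi> 0" by (simp only: card.empty)
  qed
  also have "\<dots> = \<phi> 0 ^ (N + 1 - k)"
    using card_Diff_subset[OF _ sub] card_image[OF g(2)] by simp
  also have "(\<Prod>j\<in>g ` {1..k}. \<phi> (card {i \<in> {1..n}. f i = j})) = (\<Prod>l=1..k. \<phi> (card (C l)))"
    unfolding prod.reindex[OF g(2)] o_def by (intro prod.cong refl) (simp only: occ)
  finally show ?thesis by (simp only: mult.commute)
qed

end

section \<open>Ties in the sample and ties in the labels\<close>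

text \<open>
  Measurability of the diagonal makes a tie between two sampled points an event. Diffuseness is stated pointwise because
  that is the form in which it enters the proof that the sites are distinct.
\<close>

locale diffuse_crm = normalized_crm \<rho> \<kappa> \<epsilon> P\<^sub>0
  for \<rho> \<kappa> \<epsilon> and P\<^sub>0 :: "'a measure" +
  assumes diagonal: "{p \<in> space (P\<^sub>0 \<Otimes>\<^sub>M P\<^sub>0). fst p = snd p} \<in> sets (P\<^sub>0 \<Otimes>\<^sub>M P\<^sub>0)"
    and diffuse: "\<And>x. x \<in> space P\<^sub>0 \<Longrightarrow> emeasure P\<^sub>0 {x} = 0"
begin

lemma pred_component_eq:
  assumes "i \<in> I" "j \<in> I"
  shows "Measurable.pred (\<Pi>\<^sub>M i\<in>I. P\<^sub>0) (\<lambda>x. x i = x j)"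
proof -
  have "Measurable.pred (P\<^sub>0 \<Otimes>\<^sub>M P\<^sub>0) (\<lambda>p. fst p = snd p)"
    unfolding pred_def by (rule diagonal)
  moreover have "(\<lambda>x. (x i, x j)) \<in> (\<Pi>\<^sub>M i\<in>I. P\<^sub>0) \<rightarrow>\<^sub>M P\<^sub>0 \<Otimes>\<^sub>M P\<^sub>0"
    using assms by measurable
  ultimately show ?thesis
    by (auto dest: measurable_compose[rotated])
qed

text \<open>
  Given all other sites, the site \<open>i\<close> would have to hit the single point \<open>\<tau> j\<close>, a null set.
\<close>

lemma AE_sites_neq:
  assumes ij: "i \<in> {0..N}" "j \<in> {0..N}" "i \<noteq> j"
  shows "AE \<tau> in sites N. \<tau> i \<noteq> \<tau> j"
proof -
  let ?I = "{0..N} - {i}"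
  interpret P: product_sigma_finite "\<lambda>_::nat. P\<^sub>0"
    by unfold_locales
  have I: "insert i ?I = {0..N}" using ij by auto
  have [measurable]: "Measurable.pred (sites N) (\<lambda>\<tau>. \<tau> i = \<tau> j)"
    by (rule pred_component_eq[OF ij(1,2)])
  have "emeasure (sites N) {\<tau> \<in> space (sites N). \<tau> i = \<tau> j} =
      (\<integral>\<^sup>+\<tau>. indicator {\<tau> \<in> space (sites N). \<tau> i = \<tau> j} \<tau> \<partial>sites N)"
    by simp
  also have "\<dots> = (\<integral>\<^sup>+x. (\<integral>\<^sup>+y. indicator {\<tau> \<in> space (sites N). \<tau> i = \<tau> j} (x(i := y)) \<partial>P\<^sub>0)
      \<partial>(\<Pi>\<^sub>M i\<in>?I. P\<^sub>0))"
    using P.product_nn_integral_insert[of ?I i "indicator {\<tau> \<in> space (sites N). \<tau> i = \<tau> j}"]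
    unfolding I by simp
  also have "\<dots> = (\<integral>\<^sup>+x. 0 \<partial>(\<Pi>\<^sub>M i\<in>?I. P\<^sub>0))"
  proof (rule nn_integral_cong)
    fix x assume x: "x \<in> space (\<Pi>\<^sub>M i\<in>?I. P\<^sub>0)"
    have xj: "x j \<in> space P\<^sub>0" using x ij by (auto simp: space_PiM PiE_iff)
    have "(\<integral>\<^sup>+y. indicator {\<tau> \<in> space (sites N). \<tau> i = \<tau> j} (x(i := y)) \<partial>P\<^sub>0) \<le>
        (\<integral>\<^sup>+y. indicator {x j} y \<partial>P\<^sub>0)"
      using ij by (intro nn_integral_mono) (auto simp: indicator_def)
    also have "\<dots> = 0"
    proof -
      have "{x j} = (\<lambda>y. (y, x j)) -` {p \<in> space (P\<^sub>0 \<Otimes>\<^sub>M P\<^sub>0). fst p = snd p} \<inter> space P\<^sub>0"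
        using xj by (auto simp: space_pair_measure)
      moreover have "\<dots> \<in> sets P\<^sub>0"
        by (rule measurable_sets[OF measurable_Pair2'[OF xj] diagonal])
      ultimately have "{x j} \<in> sets P\<^sub>0" by (simp only:)
      then show ?thesis using diffuse[OF xj] by simp
    qed
    finally show "(\<integral>\<^sup>+y. indicator {\<tau> \<in> space (sites N). \<tau> i = \<tau> j} (x(i := y)) \<partial>P\<^sub>0) = 0"
      by simp
  qed
  finally have "emeasure (sites N) {\<tau> \<in> space (sites N). \<tau> i = \<tau> j} = 0" by simp
  then show ?thesis
    by (intro AE_I[where N = "{\<tau> \<in> space (sites N). \<tau> i = \<tau> j}"]) auto
qed

lemma AE_sites_inj: "AE \<tau> in sites N. inj_on \<tau> {0..N}"
proof -
  have "AE \<tau> in sites N. \<forall>i\<in>{0..N}. \<forall>j\<in>{0..N}. i \<noteq> j \<longrightarrow> \<tau> i \<noteq> \<tau> j"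
    using AE_sites_neq by (auto simp: AE_ball_countable AE_finite_all intro!: AE_finite_allI)
  then show ?thesis
    by eventually_elim (auto simp: inj_on_def)
qed

end

locale diffuse_crm_partition = diffuse_crm \<rho> \<kappa> \<epsilon> P\<^sub>0 + indexed_partition n k C
  for \<rho> \<kappa> \<epsilon> and P\<^sub>0 :: "'a measure" and n k C +
  assumes n_pos: "n \<ge> 1" and k_pos: "k \<ge> 1"
begin

definition tie_event :: "(nat \<Rightarrow> 'a) set" where
  "tie_event = {x \<in> space (\<Pi>\<^sub>M i\<in>{1..n}. P\<^sub>0). tie_partition n x = C ` {1..k}}"

lemma tie_event_sets: "tie_event \<in> sets (\<Pi>\<^sub>M i\<in>{1..n}. P\<^sub>0)"
  unfolding tie_event_def tie_partition_eq_iff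
proof (intro sets.sets_Collect_finite_All sets.sets_Collect_finite_All')
  fix i j assume "i \<in> {1..n}" "j \<in> {1..n}"
  then have "Measurable.pred (\<Pi>\<^sub>M i\<in>{1..n}. P\<^sub>0) (\<lambda>x. x i = x j)"
    by (rule pred_component_eq)
  then show "{x \<in> space (\<Pi>\<^sub>M i\<in>{1..n}. P\<^sub>0). (x i = x j) = (block i = block j)}
      \<in> sets (\<Pi>\<^sub>M i\<in>{1..n}. P\<^sub>0)"
    by measurable
qed auto

text \<open>
  Almost surely the sites are distinct, so the ties in the sample are exactly the ties in the
  labels, and these are deterministic.
\<close>

lemma emeasure_labelled_sites_tie_event:
  assumes f: "f \<in> {1..n} \<rightarrow>\<^sub>E {0..N}"
  shows "emeasure (labelled_sites n N f) tie_event = indicator (labellings N) f"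
proof -
  interpret S: prob_space "sites N" by (rule prob_space_sites)
  let ?R = "\<lambda>\<tau>. \<lambda>i\<in>{1..n}. \<tau> (f i)"
  have "emeasure (labelled_sites n N f) tie_event =
      emeasure (sites N) (?R -` tie_event \<inter> space (sites N))"
    unfolding labelled_sites_def by (rule emeasure_distr[OF relabel_measurable[OF f] tie_event_sets])
  also have "\<dots> = emeasure (sites N) {\<tau> \<in> space (sites N). f \<in> labellings N}"
  proof (rule emeasure_eq_AE)
    show "AE \<tau> in sites N. \<tau> \<in> ?R -` tie_event \<inter> space (sites N) \<longleftrightarrow>
        \<tau> \<in> {\<tau> \<in> space (sites N). f \<in> labellings N}"
      using AE_sites_inj AE_space
    proof eventually_elim
      case (elim \<tau>)
      have "?R \<tau> \<in> space (\<Pi>\<^sub>M i\<in>{1..n}. P\<^sub>0)"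
        by (rule measurable_space[OF relabel_measurable[OF f] elim(2)])
      moreover have "\<tau> (f i) = \<tau> (f j) \<longleftrightarrow> f i = f j" if "i \<in> {1..n}" "j \<in> {1..n}" for i j
        by (rule inj_on_eq_iff[OF elim(1) PiE_mem[OF f that(1)] PiE_mem[OF f that(2)]])
      then have "tie_partition n (?R \<tau>) = C ` {1..k} \<longleftrightarrow> tie_partition n f = C ` {1..k}"
        unfolding tie_partition_eq_iff by simp
      ultimately show ?case
        using elim(2) f by (simp add: tie_event_def labellings_def)
    qed
    show "?R -` tie_event \<inter> space (sites N) \<in> sets (sites N)"
      by (rule measurable_sets[OF relabel_measurable[OF f] tie_event_sets])
  qed simp
  also have "\<dots> = indicator (labellings N) f"
    using S.emeasure_space_1 by (cases "f \<in> labellings N") simp_all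
  finally show ?thesis .
qed

end

section \<open>The partition probability\<close>

context diffuse_crm_partition begin

definition eppf_integrand :: "real \<Rightarrow> real" where
  "eppf_integrand u = u ^ (n - 1) / Gamma (real n) * ((real k + tilted_moment 0 u) / \<Lambda>) *
     exp (tilted_moment 0 u - \<Lambda>) * (\<Prod>l=1..k. tilted_moment (card (C l)) u)"

lemma eppf_integrand_nonneg: "u > 0 \<Longrightarrow> 0 \<le> eppf_integrand u"
  unfolding eppf_integrand_def
  using tilted_moment_nonneg Lambda_pos n_pos
  by (intro mult_nonneg_nonneg divide_nonneg_nonneg prod_nonneg)
    (auto intro: less_imp_le add_nonneg_nonneg)

lemma eppf_integrand_measurable [measurable]: "eppf_integrand \<in> borel_measurable borel"
  unfolding eppf_integrand_def[abs_def] by measurable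

text \<open>
  The weight is the same for all admissible labellings, which is why only their number matters.
\<close>

lemma label_weight_labelling:
  assumes f: "f \<in> labellings N"
  shows "label_weight n N f = (\<integral>\<^sup>+u\<in>{0<..}. ennreal (u ^ (n - 1) / Gamma (real n) *
     (\<Prod>l=1..k. tilted_moment (card (C l)) u / \<Lambda>) * (tilted_moment 0 u / \<Lambda>) ^ (N + 1 - k)) \<partial>lborel)"
proof -
  have "f ` {1..n} \<subseteq> {0..N}" using f by (auto simp: labellings_def)
  then have "label_weight n N f = (\<integral>\<^sup>+u\<in>{0<..}. ennreal (u ^ (n - 1) / Gamma (real n)) *
       (\<Prod>j=0..N. ennreal (tilted_moment (card {i \<in> {1..n}. f i = j}) u / \<Lambda>)) \<partial>lborel)"
    unfolding label_weight_def by (intro expectation_normalized_jumps n_pos) auto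
  also have "\<dots> = (\<integral>\<^sup>+u\<in>{0<..}. ennreal (u ^ (n - 1) / Gamma (real n) *
     (\<Prod>l=1..k. tilted_moment (card (C l)) u / \<Lambda>) * (tilted_moment 0 u / \<Lambda>) ^ (N + 1 - k)) \<partial>lborel)"
  proof (intro nn_integral_cong)
    fix u :: real
    have nonneg: "0 \<le> tilted_moment m u / \<Lambda>" for m
      using tilted_moment_nonneg Lambda_pos by simp
    have "(\<Prod>j=0..N. ennreal (tilted_moment (card {i \<in> {1..n}. f i = j}) u / \<Lambda>)) =
        ennreal (\<Prod>j=0..N. tilted_moment (card {i \<in> {1..n}. f i = j}) u / \<Lambda>)"
      by (intro prod_ennreal nonneg)
    also have "(\<Prod>j=0..N. tilted_moment (card {i \<in> {1..n}. f i = j}) u / \<Lambda>) =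
        (\<Prod>l=1..k. tilted_moment (card (C l)) u / \<Lambda>) * (tilted_moment 0 u / \<Lambda>) ^ (N + 1 - k)"
      by (rule prod_labelling[OF f, where \<phi> = "\<lambda>m. tilted_moment m u / \<Lambda>"])
    finally have "ennreal (u ^ (n - 1) / Gamma (real n)) *
       (\<Prod>j=0..N. ennreal (tilted_moment (card {i \<in> {1..n}. f i = j}) u / \<Lambda>)) =
      ennreal (u ^ (n - 1) / Gamma (real n) * ((\<Prod>l=1..k. tilted_moment (card (C l)) u / \<Lambda>) *
        (tilted_moment 0 u / \<Lambda>) ^ (N + 1 - k)))"
      using nonneg by (subst ennreal_mult'') (auto intro!: mult_nonneg_nonneg prod_nonneg)
    then show "ennreal (u ^ (n - 1) / Gamma (real n)) *
       (\<Prod>j=0..N. ennreal (tilted_moment (card {i \<in> {1..n}. f i = j}) u / \<Lambda>)) * indicator {0<..} u =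
      ennreal (u ^ (n - 1) / Gamma (real n) *
       (\<Prod>l=1..k. tilted_moment (card (C l)) u / \<Lambda>) * (tilted_moment 0 u / \<Lambda>) ^ (N + 1 - k)) *
      indicator {0<..} u"
      by (simp only: mult.assoc)
  qed
  finally show ?thesis .
qed

text \<open>
  Tonelli moves the sum over the number of atoms inside the integral over \<open>u\<close>, where it is the
  Poisson series with \<open>y = \<Lambda>\<^sub>\<epsilon>\<^sub>,\<^sub>u\<close>.
\<close>

lemma emeasure_tie_event:
  "emeasure (label_mixture n) tie_event = (\<integral>\<^sup>+u\<in>{0<..}. ennreal (eppf_integrand u) \<partial>lborel)"
proof -
  let ?c = "\<lambda>u. u ^ (n - 1) / Gamma (real n) * (\<Prod>l=1..k. tilted_moment (card (C l)) u / \<Lambda>)"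
  let ?x = "\<lambda>u. tilted_moment 0 u / \<Lambda>"
  let ?t = "\<lambda>u N. pmf (poisson_pmf \<Lambda>) N * real (\<Prod>i<k. N + 1 - i) * ?x u ^ (N + 1 - k)"
  have c: "0 \<le> ?c u" if "u > 0" for u
    using tilted_moment_nonneg Lambda_pos n_pos that
    by (intro mult_nonneg_nonneg divide_nonneg_nonneg prod_nonneg) (auto intro: less_imp_le)
  have t: "0 \<le> ?t u N" for u N
    using tilted_moment_nonneg Lambda_pos
    by (intro mult_nonneg_nonneg pmf_nonneg of_nat_0_le_iff zero_le_power divide_nonneg_pos)
  have "emeasure (label_mixture n) tie_event =
      (\<integral>\<^sup>+N. (\<Sum>f\<in>{1..n} \<rightarrow>\<^sub>E {0..N}. label_weight n N f * emeasure (labelled_sites n N f) tie_event)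
        \<partial>measure_pmf (poisson_pmf \<Lambda>))"
    by (rule emeasure_label_mixture[OF tie_event_sets])
  also have "\<dots> = (\<integral>\<^sup>+N. of_nat (card (labellings N)) *
      (\<integral>\<^sup>+u\<in>{0<..}. ennreal (?c u * ?x u ^ (N + 1 - k)) \<partial>lborel) \<partial>measure_pmf (poisson_pmf \<Lambda>))"
  proof (rule nn_integral_cong)
    fix N
    have "(\<Sum>f\<in>{1..n} \<rightarrow>\<^sub>E {0..N}. label_weight n N f * emeasure (labelled_sites n N f) tie_event) =
        (\<Sum>f\<in>labellings N. label_weight n N f)"
      by (rule sum.mono_neutral_cong_right)
        (auto simp: emeasure_labelled_sites_tie_event labellings_def intro!: finite_PiE)
    also have "\<dots> = (\<Sum>f\<in>labellings N.
        (\<integral>\<^sup>+u\<in>{0<..}. ennreal (?c u * ?x u ^ (N + 1 - k)) \<partial>lborel))"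
      by (intro sum.cong refl label_weight_labelling)
    finally show "(\<Sum>f\<in>{1..n} \<rightarrow>\<^sub>E {0..N}. label_weight n N f *
          emeasure (labelled_sites n N f) tie_event) =
        of_nat (card (labellings N)) *
        (\<integral>\<^sup>+u\<in>{0<..}. ennreal (?c u * ?x u ^ (N + 1 - k)) \<partial>lborel)"
      by simp
  qed
  also have "\<dots> = (\<Sum>N. ennreal (pmf (poisson_pmf \<Lambda>) N) * (of_nat (card (labellings N)) *
      (\<integral>\<^sup>+u\<in>{0<..}. ennreal (?c u * ?x u ^ (N + 1 - k)) \<partial>lborel)))"
    unfolding nn_integral_measure_pmf by (rule nn_integral_count_space_nat)
  also have "\<dots> = (\<Sum>N. (\<integral>\<^sup>+u. ennreal (?c u * ?t u N) * indicator {0<..} u \<partial>lborel))"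
  proof (intro suminf_cong)
    fix N
    have "ennreal (pmf (poisson_pmf \<Lambda>) N) * (of_nat (card (labellings N)) *
        (\<integral>\<^sup>+u\<in>{0<..}. ennreal (?c u * ?x u ^ (N + 1 - k)) \<partial>lborel)) =
      (\<integral>\<^sup>+u. ennreal (pmf (poisson_pmf \<Lambda>) N * real (card (labellings N))) *
        (ennreal (?c u * ?x u ^ (N + 1 - k)) * indicator {0<..} u) \<partial>lborel)"
      by (subst nn_integral_cmult) (simp_all add: ennreal_mult' mult.assoc flip: ennreal_of_nat_eq_real_of_nat)
    also have "\<dots> = (\<integral>\<^sup>+u. ennreal (?c u * ?t u N) * indicator {0<..} u \<partial>lborel)"
      unfolding card_labellings
      by (intro nn_integral_cong)
        (simp add: indicator_def mult_ac del: of_nat_prod flip: ennreal_mult')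
    finally show "ennreal (pmf (poisson_pmf \<Lambda>) N) * (of_nat (card (labellings N)) *
        (\<integral>\<^sup>+u\<in>{0<..}. ennreal (?c u * ?x u ^ (N + 1 - k)) \<partial>lborel)) =
      (\<integral>\<^sup>+u. ennreal (?c u * ?t u N) * indicator {0<..} u \<partial>lborel)" .
  qed
  also have "\<dots> = (\<integral>\<^sup>+u. (\<Sum>N. ennreal (?c u * ?t u N) * indicator {0<..} u) \<partial>lborel)"
    by (rule nn_integral_suminf[symmetric]) measurable
  also have "\<dots> = (\<integral>\<^sup>+u\<in>{0<..}. ennreal (eppf_integrand u) \<partial>lborel)"
  proof (intro nn_integral_cong)
    fix u :: real
    show "(\<Sum>N. ennreal (?c u * ?t u N) * indicator {0<..} u) =
        ennreal (eppf_integrand u) * indicator {0<..} u"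
    proof (cases "u > 0")
      case True
      let ?y = "tilted_moment 0 u"
      have "(\<lambda>N. ?c u * ?t u N) sums
          (?c u * (exp (- \<Lambda>) * \<Lambda> ^ (k - 1) * ((real k + ?y) * exp ?y)))"
        by (intro sums_mult poisson_factorial_moment_series Lambda_pos k_pos)
      moreover have "?c u * (exp (- \<Lambda>) * \<Lambda> ^ (k - 1) * ((real k + ?y) * exp ?y)) = eppf_integrand u"
      proof -
        have "\<Lambda> ^ k = \<Lambda> * \<Lambda> ^ (k - 1)"
          using k_pos by (simp flip: power_Suc)
        moreover have "Gamma (real n) \<noteq> 0"
          by (rule less_imp_neq[THEN not_sym], rule Gamma_real_pos) (use n_pos in simp)
        ultimately show ?thesis
          using Lambda_pos
          by (simp add: eppf_integrand_def prod_dividef exp_diff exp_minus field_simps)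
      qed
      ultimately have sums: "(\<lambda>N. ?c u * ?t u N) sums eppf_integrand u" by simp
      have "(\<Sum>N. ennreal (?c u * ?t u N)) = ennreal (eppf_integrand u)"
      proof (subst suminf_ennreal2)
        show "0 \<le> ?c u * ?t u N" for N
          by (rule mult_nonneg_nonneg[OF c[OF True] t])
      qed (use sums_summable[OF sums] sums_unique[OF sums] in simp_all)
      then show ?thesis using True by simp
    qed simp
  qed
  finally show ?thesis .
qed

text \<open>
  The integral of the nonnegative integrand is a probability, hence finite; this is what gives
  integrability.
\<close>

lemma eppf_formula:
  assumes M: "prob_space M" and Q: "random_prob_measure M P\<^sub>0 Q"
    and law: "distr M (prob_algebra P\<^sub>0) Q = eps_NormCRM \<rho> \<kappa> P\<^sub>0 \<epsilon>"
    and sample: "sample_from M P\<^sub>0 Q n \<theta>"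
  shows "set_integrable lborel {0<..} eppf_integrand"
    and "eppf M n \<theta> (C ` {1..k}) = (LBINT u:{0<..}. eppf_integrand u)"
proof -
  interpret M: prob_space M by (rule M)
  let ?P = "\<Pi>\<^sub>M i\<in>{1..n}. P\<^sub>0"
  let ?X = "\<lambda>\<omega>. \<lambda>i\<in>{1..n}. \<theta> i \<omega>"
  have X: "?X \<in> M \<rightarrow>\<^sub>M ?P"
    using sample by (intro measurable_restrict) (simp add: sample_from_def)
  have "emeasure (distr M ?P ?X) tie_event =
      emeasure M {\<omega> \<in> space M. tie_partition n (\<lambda>i. \<theta> i \<omega>) = C ` {1..k}}"
    unfolding emeasure_distr[OF X tie_event_sets]
  proof (intro arg_cong[where f = "emeasure M"] set_eqI)
    fix \<omega>
    have "tie_partition n (?X \<omega>) = tie_partition n (\<lambda>i. \<theta> i \<omega>)"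
    proof -
      have "{(i, j). i \<in> {1..n} \<and> j \<in> {1..n} \<and> ?X \<omega> i = ?X \<omega> j} =
          {(i, j). i \<in> {1..n} \<and> j \<in> {1..n} \<and> \<theta> i \<omega> = \<theta> j \<omega>}"
        by auto
      then show ?thesis unfolding tie_partition_def by (simp only:)
    qed
    then show "\<omega> \<in> ?X -` tie_event \<inter> space M \<longleftrightarrow>
        \<omega> \<in> {\<omega> \<in> space M. tie_partition n (\<lambda>i. \<theta> i \<omega>) = C ` {1..k}}"
      using measurable_space[OF X, of \<omega>] by (auto simp: tie_event_def)
  qed
  then have em: "(\<integral>\<^sup>+u\<in>{0<..}. ennreal (eppf_integrand u) \<partial>lborel) =
      ennreal (eppf M n \<theta> (C ` {1..k}))"
    unfolding eppf_def sample_law[OF M Q law sample] emeasure_tie_event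
    by (simp add: M.emeasure_eq_measure)
  have em': "(\<integral>\<^sup>+u. ennreal (indicator {0<..} u *\<^sub>R eppf_integrand u) \<partial>lborel) =
      ennreal (eppf M n \<theta> (C ` {1..k}))"
    unfolding em[symmetric] by (intro nn_integral_cong) (auto simp: indicator_def)
  have nonneg: "0 \<le> indicator {0<..} u *\<^sub>R eppf_integrand u" for u
    using eppf_integrand_nonneg[of u] by (auto simp: indicator_def)
  show "set_integrable lborel {0<..} eppf_integrand"
    unfolding set_integrable_def
    by (rule integrableI_nonneg) (use nonneg em' in auto)
  show "eppf M n \<theta> (C ` {1..k}) = (LBINT u:{0<..}. eppf_integrand u)"
    unfolding set_lebesgue_integral_def
    using em' nonneg by (subst integral_eq_nn_integral) (auto simp: eppf_def)
qed

end

lemma diagonal_restricted_borel: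
  fixes P :: "'a::{second_countable_topology, metric_space} measure"
  assumes "sets P = sets (restrict_space borel S)"
  shows "{p \<in> space (P \<Otimes>\<^sub>M P). fst p = snd p} \<in> sets (P \<Otimes>\<^sub>M P)"
proof -
  have [measurable]: "(\<lambda>x. x) \<in> P \<rightarrow>\<^sub>M borel"
    by (subst measurable_cong_sets[OF assms refl]) (rule measurable_restrict_space1, simp)
  have [measurable]: "fst \<in> P \<Otimes>\<^sub>M P \<rightarrow>\<^sub>M borel" "snd \<in> P \<Otimes>\<^sub>M P \<rightarrow>\<^sub>M borel"
    by (auto intro: measurable_compose[OF measurable_fst] measurable_compose[OF measurable_snd])
  have "{p \<in> space (P \<Otimes>\<^sub>M P). dist (fst p) (snd p) = 0} \<in> sets (P \<Otimes>\<^sub>M P)"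
    by measurable
  then show ?thesis by simp
qed

text \<open>
  A measurable singleton of positive mass has only trivial subsets, so it would be an atom.
\<close>

lemma non_atomic_singleton_null:
  assumes "non_atomic P" "{x} \<in> sets P"
  shows "emeasure P {x} = 0"
proof (rule ccontr)
  assume "emeasure P {x} \<noteq> 0"
  then have "atom_of P {x}"
    unfolding atom_of_def using assms(2)
    by (auto simp: subset_singleton_iff zero_less_iff_neq_zero)
  then show False using assms(1) unfolding non_atomic_def by blast
qed

theorem proposition1:
  fixes \<Theta> :: "(real ^ 'm) set"
    and P\<^sub>0 :: "(real ^ 'm) measure"
    and \<rho> :: "real \<Rightarrow> real" and \<kappa> \<epsilon> :: real
    and M :: "'w measure"
    and P\<^sub>\<epsilon> :: "'w \<Rightarrow> (real ^ 'm) measure"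
    and \<theta> :: "nat \<Rightarrow> 'w \<Rightarrow> real ^ 'm"
    and n k :: nat and ns :: "nat \<Rightarrow> nat" and C :: "nat \<Rightarrow> nat set"
  assumes "\<Theta> \<in> sets borel"
    and "prob_space P\<^sub>0" and "sets P\<^sub>0 = sets (restrict_space borel \<Theta>)"
    and "non_atomic P\<^sub>0"
    and "\<kappa> > 0" and "jump_intensity \<rho>"
    and "\<epsilon> > 0" and "Lambda_eps \<rho> \<kappa> \<epsilon> > 0"
    and "prob_space M"
    and "random_prob_measure M (restrict_space borel \<Theta>) P\<^sub>\<epsilon>"
    and "distr M (prob_algebra (restrict_space borel \<Theta>)) P\<^sub>\<epsilon> = eps_NormCRM \<rho> \<kappa> P\<^sub>0 \<epsilon>"
    and "sample_from M (restrict_space borel \<Theta>) P\<^sub>\<epsilon> n \<theta>"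
    and "k \<ge> 1" and "\<forall>i\<in>{1..k}. ns i \<ge> 1" and "(\<Sum>i=1..k. ns i) = n"
    and "partition_on {1..n} (C ` {1..k})" and "inj_on C {1..k}"
    and "\<forall>i\<in>{1..k}. card (C i) = ns i"
  shows
    "let f = (\<lambda>u. u ^ (n - 1) / Gamma (real n)
               * ((real k + Lambda_eps_u \<rho> \<kappa> \<epsilon> u) / Lambda_eps \<rho> \<kappa> \<epsilon>)
               * exp (Lambda_eps_u \<rho> \<kappa> \<epsilon> u - Lambda_eps \<rho> \<kappa> \<epsilon>)
               * (\<Prod>i=1..k. (LBINT s:{\<epsilon><..}. \<kappa> * s ^ ns i * exp (- u * s) * \<rho> s)))
     in set_integrable lborel {0<..} f \<and>
        eppf M n \<theta> (C ` {1..k}) = (LBINT u:{0<..}. f u)"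
proof -
  let ?S = "restrict_space borel \<Theta>"
  note sets_P0 = \<open>sets P\<^sub>0 = sets ?S\<close>
  have space_P0: "space P\<^sub>0 = \<Theta>"
    using sets_eq_imp_space_eq[OF sets_P0] by (simp add: space_restrict_space)
  have "n \<ge> 1"
  proof -
    have "ns 1 \<le> (\<Sum>i=1..k. ns i)" using \<open>k \<ge> 1\<close> by (intro member_le_sum) auto
    then show ?thesis using assms(13-15) by force
  qed
  interpret P0: prob_space P\<^sub>0 by fact
  interpret diffuse_crm_partition \<rho> \<kappa> \<epsilon> P\<^sub>0 n k C
  proof unfold_locales
    show "{p \<in> space (P\<^sub>0 \<Otimes>\<^sub>M P\<^sub>0). fst p = snd p} \<in> sets (P\<^sub>0 \<Otimes>\<^sub>M P\<^sub>0)"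
      by (rule diagonal_restricted_borel[OF sets_P0])
    show "emeasure P\<^sub>0 {x} = 0" if "x \<in> space P\<^sub>0" for x
    proof (rule non_atomic_singleton_null[OF \<open>non_atomic P\<^sub>0\<close>])
      show "{x} \<in> sets P\<^sub>0"
        using that \<open>\<Theta> \<in> sets borel\<close> by (simp add: sets_P0 space_P0 sets_restrict_space_iff)
    qed
  qed (fact assms \<open>n \<ge> 1\<close>)+
  have prob_algebra_eq: "prob_algebra ?S = prob_algebra P\<^sub>0"
    unfolding prob_algebra_def subprob_algebra_cong[OF sets_P0] ..
  have Q: "random_prob_measure M P\<^sub>0 P\<^sub>\<epsilon>"
    using assms(10) unfolding random_prob_measure_def prob_algebra_eq .
  have law: "distr M (prob_algebra P\<^sub>0) P\<^sub>\<epsilon> = eps_NormCRM \<rho> \<kappa> P\<^sub>0 \<epsilon>"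
    using assms(11) unfolding prob_algebra_eq .
  have sample: "sample_from M P\<^sub>0 P\<^sub>\<epsilon> n \<theta>"
    using assms(12)
    unfolding sample_from_def prob_algebra_eq sets_P0[symmetric]
      measurable_cong_sets[OF refl sets_P0, symmetric] .
  have moments: "(\<Prod>i=1..k. tilted_moment (card (C i)) u) =
      (\<Prod>i=1..k. (LBINT s:{\<epsilon><..}. \<kappa> * s ^ ns i * exp (- u * s) * \<rho> s))" for u
    using assms(18) unfolding tilted_moment_def by (intro prod.cong refl) simp
  have integrand: "eppf_integrand = (\<lambda>u. u ^ (n - 1) / Gamma (real n)
               * ((real k + Lambda_eps_u \<rho> \<kappa> \<epsilon> u) / Lambda_eps \<rho> \<kappa> \<epsilon>)
               * exp (Lambda_eps_u \<rho> \<kappa> \<epsilon> u - Lambda_eps \<rho> \<kappa> \<epsilon>)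
               * (\<Prod>i=1..k. (LBINT s:{\<epsilon><..}. \<kappa> * s ^ ns i * exp (- u * s) * \<rho> s)))"
    unfolding eppf_integrand_def[abs_def] Lambda_eps_u_eq_tilted_moment moments ..
  show ?thesis
    unfolding Let_def integrand[symmetric]
    using eppf_formula[OF \<open>prob_space M\<close> Q law sample] by blast
qed

end
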